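(* Let $\mathcal{G}=(\mathcal{R},\mathcal{E})$ be a connected undirected graph with vertex set $\mathcal{R}=\{1,\dots,N_r\}$, and let $\mathcal{N}_r$ denote the set of (single-hop) neighbors of $r$. Let $\mu\ge0$, and for each $r\in\mathcal{R}$ let $\mathbf{y}_r\in\mathbb{R}^{n_r}$ and $\mathbf{X}_r\in\mathbb{R}^{n_r\times p}$. Vectors of $\mathbb{R}^p$ are partitioned into $N_b$ sub-vectors, $\boldsymbol\zeta=[\boldsymbol\zeta_1^{\prime},\dots,\boldsymbol\zeta_{N_b}^{\prime}]^{\prime}$. Consider the recursions (the DGLasso algorithm), run for $k=0,1,2,\dots$ and all $r\in\mathcal{R}$ from an arbitrary initialization $\boldsymbol\zeta_r(0),\boldsymbol\gamma_r(0),\mathbf{p}_r(-1),\mathbf{v}_r(-1)\in\mathbb{R}^p$: $$\mathbf{p}_r(k)=\mathbf{p}_r(k-1)+c\sum_{r^{\prime}\in\mathcal{N}_r}[\boldsymbol\zeta_r(k)-\boldsymbol\zeta_{r^{\prime}}(k)],$$ $$\mathbf{v}_r(k)=\mathbf{v}_r(k-1)+c[\boldsymbol\zeta_r(k)-\boldsymbol\gamma_r(k)],$$ $$\boldsymbol\zeta_{r\nu}(k+1)=\frac{\mathcal{T}_\mu\Big(N_r\big(c\,\boldsymbol\gamma_{r\nu}(k)+c\sum_{r^{\prime}\in\mathcal{N}_r}[\boldsymbol\zeta_{r\nu}(k)+\boldsymbol\zeta_{r^{\prime}\nu}(k)]-\mathbf{p}_{r\nu}(k)-\mathbf{v}_{r\nu}(k)\big)\Big)}{cN_r(2|\mathcal{N}_r|+1)},\quad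 \nu=1,\dots,N_b,$$ $$\boldsymbol\gamma_r(k+1)=[c\mathbf{I}_p+\mathbf{X}_r^{\prime}\mathbf{X}_r]^{-1}\big(\mathbf{X}_r^{\prime}\mathbf{y}_r+c\boldsymbol\zeta_r(k+1)+\mathbf{v}_r(k)\big).$$ Then, for any value of the step-size $c>0$, the iterates $\boldsymbol\zeta_r(k)$ converge to the group-Lasso solution $$\hat{\boldsymbol\zeta}_{\mathrm{glasso}}=\arg\min_{\boldsymbol\zeta}\ \frac12\sum_{r=1}^{N_r}\|\mathbf{y}_r-\mathbf{X}_r\boldsymbol\zeta\|_2^2+\mu\sum_{\nu=1}^{N_b}\|\boldsymbol\zeta_\nu\|_2$$ as $k\to\infty$, i.e., $$\lim_{k\to\infty}\boldsymbol\zeta_r(k)=\hat{\boldsymbol\zeta}_{\mathrm{glasso}}\qquad\text{for all } r\in\mathcal{R}.$$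
   Context: For a vector $\mathbf{a}$, the vector soft-thresholding operator is $\mathcal{T}_\mu(\mathbf{a}):=\frac{\mathbf{a}}{\|\mathbf{a}\|_2}(\|\mathbf{a}\|_2-\mu)_+$ with $(\cdot)_+=\max\{\cdot,0\}$, and $\mathcal{T}_\mu(\mathbf{0}):=\mathbf{0}$. The subscript $r\nu$ denotes the $\nu$th sub-vector of the vector with subscript $r$, e.g. $\boldsymbol\zeta_r=[\boldsymbol\zeta_{r1}^{\prime},\dots,\boldsymbol\zeta_{rN_b}^{\prime}]^{\prime}$, and likewise for $\boldsymbol\gamma_r,\mathbf{p}_r,\mathbf{v}_r$. $|\mathcal{N}_r|$ is the number of neighbors of $r$, and $\mathbf{I}_p$ the $p\times p$ identity. Prime denotes transposition (except on the index $r^{\prime}$).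
   Formalization: The initialization is not fully arbitrary: the initial multipliers p_r(-1) are assumed to sum to zero over all r (e.g. all zero), since the claim fails otherwise; if the group-Lasso minimizer is not unique, all ζ_r(k) converge to one common minimizer. *)

theory Defs
  imports "HOL-Analysis.Analysis" "Graph_Theory.Graph_Theory"
begin

text \<open>
  The undirected graph is a \<^locale>\<open>pair_graph\<close> (finite, loop-free, with a symmetric set of arcs);
  each undirected edge is a pair of opposite arcs.
\<close>

definition neighbors :: "'a pair_pre_digraph \<Rightarrow> 'a \<Rightarrow> 'a set" where
  "neighbors G r = {s. (r, s) \<in> parcs G}"

text \<open>
  For a vector equal to 0 the value is 0, because division by 0 yields 0.
\<close>

definition soft_threshold :: "real \<Rightarrow> 'v::real_normed_vector \<Rightarrow> 'v" where
  "soft_threshold \<mu> a = (max (norm a - \<mu>) 0 / norm a) *\<^sub>R a"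

text \<open>
  The sub-vector of \<open>z\<close> with index set \<open>B\<close>, embedded isometrically in the full space by zeros
  outside \<open>B\<close>, so that sub-vectors of different sizes have the same type.
\<close>

definition subvec :: "'p set \<Rightarrow> real ^ 'p \<Rightarrow> real ^ 'p::finite" where
  "subvec B z = (\<chi> i. if i \<in> B then z $ i else 0)"

text \<open>
  The number of rows of a data matrix depends on the agent.  A matrix with
  \<open>m\<close> rows is therefore given by the number \<open>m\<close> and a sequence \<open>X\<close> of rows,
  and a vector of length \<open>m\<close> by \<open>m\<close> and a sequence \<open>w\<close> of reals; only the entries with index below
  \<open>m\<close> count.  The next four functions are \<open>X z\<close>, the squared Euclidean norm of \<open>w\<close>,
  \<open>X' w\<close> and \<open>X' X\<close>.
\<close>

definition mat_mult_vec :: "(nat \<Rightarrow> real ^ 'p) \<Rightarrow> real ^ 'p::finite \<Rightarrow> nat \<Rightarrow> real" where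
  "mat_mult_vec X z i = (\<Sum>j\<in>UNIV. X i $ j * z $ j)"

definition sq_norm :: "nat \<Rightarrow> (nat \<Rightarrow> real) \<Rightarrow> real" where
  "sq_norm m w = (\<Sum>i<m. (w i)\<^sup>2)"

definition transpose_mult_vec ::
  "nat \<Rightarrow> (nat \<Rightarrow> real ^ 'p) \<Rightarrow> (nat \<Rightarrow> real) \<Rightarrow> real ^ 'p::finite" where
  "transpose_mult_vec m X w = (\<chi> j. \<Sum>i<m. X i $ j * w i)"

definition gram :: "nat \<Rightarrow> (nat \<Rightarrow> real ^ 'p) \<Rightarrow> real ^ 'p ^ 'p::finite" where
  "gram m X = (\<chi> j l. \<Sum>i<m. X i $ j * X i $ l)"

text \<open>
  In the following, \<open>R\<close> is the set of agents, \<open>B 1, \<dots>, B Nb\<close> are the index sets of the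
  sub-vectors, and agent \<open>r\<close> holds \<open>n r\<close> data with design matrix \<open>X r\<close> and response \<open>y r\<close>.
\<close>

definition glasso_cost ::
  "'a set \<Rightarrow> real \<Rightarrow> nat \<Rightarrow> (nat \<Rightarrow> 'p set) \<Rightarrow> ('a \<Rightarrow> nat) \<Rightarrow> ('a \<Rightarrow> nat \<Rightarrow> real ^ 'p) \<Rightarrow>
   ('a \<Rightarrow> nat \<Rightarrow> real) \<Rightarrow> real ^ 'p::finite \<Rightarrow> real" where
  "glasso_cost R \<mu> Nb B n X y z =
     1 / 2 * (\<Sum>r\<in>R. sq_norm (n r) (\<lambda>i. y r i - mat_mult_vec (X r) z i))
     + \<mu> * (\<Sum>\<nu>\<in>{1..Nb}. norm (subvec (B \<nu>) z))"

text \<open>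
  The multipliers \<open>p\<close> and \<open>v\<close> are indexed by integers since their initial values have time
  index \<open>-1\<close>; their values at earlier times are irrelevant.
\<close>

definition dglasso_iterates ::
  "'a pair_pre_digraph \<Rightarrow> real \<Rightarrow> real \<Rightarrow> nat \<Rightarrow> (nat \<Rightarrow> 'p set) \<Rightarrow> ('a \<Rightarrow> nat) \<Rightarrow>
   ('a \<Rightarrow> nat \<Rightarrow> real ^ 'p) \<Rightarrow> ('a \<Rightarrow> nat \<Rightarrow> real) \<Rightarrow>
   ('a \<Rightarrow> nat \<Rightarrow> real ^ 'p) \<Rightarrow> ('a \<Rightarrow> nat \<Rightarrow> real ^ 'p) \<Rightarrow>
   ('a \<Rightarrow> int \<Rightarrow> real ^ 'p) \<Rightarrow> ('a \<Rightarrow> int \<Rightarrow> real ^ 'p::finite) \<Rightarrow> bool" where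
  "dglasso_iterates G c \<mu> Nb B n X y \<zeta> \<gamma> p v \<longleftrightarrow>
     (\<forall>k::nat. \<forall>r\<in>pverts G.
        p r (int k) = p r (int k - 1) + c *\<^sub>R (\<Sum>s\<in>neighbors G r. \<zeta> r k - \<zeta> s k)
      \<and> v r (int k) = v r (int k - 1) + c *\<^sub>R (\<zeta> r k - \<gamma> r k)
      \<and> (\<forall>\<nu>\<in>{1..Nb}.
           subvec (B \<nu>) (\<zeta> r (k + 1)) =
             (1 / (c * real (card (pverts G)) * (2 * real (card (neighbors G r)) + 1))) *\<^sub>R
             soft_threshold \<mu>
               (real (card (pverts G)) *\<^sub>R
                 (c *\<^sub>R subvec (B \<nu>) (\<gamma> r k)
                  + c *\<^sub>R (\<Sum>s\<in>neighbors G r. subvec (B \<nu>) (\<zeta> r k) + subvec (B \<nu>) (\<zeta> s k))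
                  - subvec (B \<nu>) (p r (int k)) - subvec (B \<nu>) (v r (int k)))))
      \<and> \<gamma> r (k + 1) =
          matrix_inv (c *\<^sub>R mat 1 + gram (n r) (X r)) *v
            (transpose_mult_vec (n r) (X r) (y r) + c *\<^sub>R \<zeta> r (k + 1) + v r (int k)))"

end

theory Submission
  imports Defs
begin

text \<open>
  With \<open>h = \<mu> * (\<Sum>\<nu>. norm (subvec (B \<nu>) z))\<close>, the updates say that \<open>card R\<close> times
  \<open>c (\<gamma> r k - \<gamma> r (k+1)) - v r (k+1) - p r (k+1) + c (\<Sum>s. \<zeta> r k + \<zeta> s k - \<zeta> r (k+1) - \<zeta> s (k+1))\<close>
  is a subgradient of \<open>h\<close> at \<open>\<zeta> r (k+1)\<close>, and that \<open>v r (k+1)\<close> is the gradient of the loss of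
  agent \<open>r\<close> at \<open>\<gamma> r (k+1)\<close>.  Since \<open>p\<close> sums to zero and the graph is connected, \<open>p\<close> is the
  divergence of an antisymmetric flow on the arcs.  Monotonicity of subgradients and gradients shows
  that a weighted squared distance to any saddle point decreases, by at least the squared length of
  the step.  Hence the iterates are bounded and the steps tend to zero; the limit of a convergent
  subsequence is again a saddle point, the distance to it decreases and has a subsequence tending to
  zero, so the whole sequence converges.  A saddle point exists because the cost has a minimizer.
\<close>

section \<open>Flows on a symmetric graph\<close>

lemma sum_neighbors_eq_sum_arcs:
  assumes "finite R" "E \<subseteq> R \<times> R"
  shows "(\<Sum>r\<in>R. \<Sum>s\<in>E `` {r}. f r s) = (\<Sum>(r, s)\<in>E. f r s)"
proof -
  have "finite (E `` {r})" for r
    using assms by (meson finite_Image finite_SigmaI finite_subset)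
  moreover have "Sigma R (\<lambda>r. E `` {r}) = E"
    using assms by auto
  ultimately show ?thesis
    using assms by (simp add: sum.Sigma)
qed

lemma sum_arcs_swap:
  assumes "sym E"
  shows "(\<Sum>(r, s)\<in>E. f r s) = (\<Sum>(r, s)\<in>E. f s r)"
  by (rule sum.reindex_bij_witness[of _ prod.swap prod.swap])
    (use assms in \<open>auto dest: symD\<close>)

text \<open>Divergences of antisymmetric flows are closed under addition and include the transport
  along each arc, hence along each path. A family \<open>q\<close> of sum zero is the sum of the
  transports of \<open>q a\<close> from \<open>a\<close> to one fixed root.\<close>

lemma antisymmetric_flow_exists:
  fixes q :: "'a \<Rightarrow> 'v::real_vector"
  assumes fin: "finite R" and ER: "E \<subseteq> R \<times> R" and sym: "sym E"
    and conn: "\<And>r s. r \<in> R \<Longrightarrow> s \<in> R \<Longrightarrow> (r, s) \<in> E\<^sup>*"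
    and q: "sum q R = 0"
  obtains l where "\<And>r s. l s r = - l r s" "\<And>r. r \<in> R \<Longrightarrow> (\<Sum>s\<in>E `` {r}. l r s) = q r"
proof -
  define flow where "flow u \<longleftrightarrow>
    (\<exists>l. (\<forall>r s. l r s + l s r = 0) \<and> (\<forall>r\<in>R. (\<Sum>s\<in>E `` {r}. l r s) = u r))"
    for u :: "'a \<Rightarrow> 'v"
  have finE: "finite (E `` {r})" for r
    using fin ER by (meson finite_Image finite_SigmaI finite_subset)
  have flow_0: "flow (\<lambda>_. 0)"
    unfolding flow_def by (rule exI[of _ "\<lambda>_ _. 0"]) simp
  have flow_add: "flow (\<lambda>r. u r + w r)" if u: "flow u" and w: "flow w" for u w
  proof -
    obtain l m where l: "\<forall>r s. l r s + l s r = 0" "\<forall>r\<in>R. (\<Sum>s\<in>E `` {r}. l r s) = u r"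
      and m: "\<forall>r s. m r s + m s r = 0" "\<forall>r\<in>R. (\<Sum>s\<in>E `` {r}. m r s) = w r"
      using u w unfolding flow_def by blast
    have "(l r s + m r s) + (l s r + m s r) = 0" for r s
      using l(1) m(1) by (metis add.assoc add.commute add.right_neutral)
    then show ?thesis
      unfolding flow_def using l(2) m(2)
      by (intro exI[of _ "\<lambda>r s. l r s + m r s"]) (simp add: sum.distrib)
  qed
  have flow_sum: "flow (\<lambda>r. \<Sum>a\<in>A. u a r)" if "\<And>a. a \<in> A \<Longrightarrow> flow (u a)" "finite A"
    for A and u :: "'a \<Rightarrow> 'a \<Rightarrow> 'v"
    using that(2,1)
  proof (induction A rule: finite_induct)
    case empty
    then show ?case using flow_0 by simp
  next
    case (insert a A)
    then show ?case using flow_add[of "u a" "\<lambda>r. \<Sum>a\<in>A. u a r"] by simp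
  qed
  \<comment> \<open>The divergence of a flow carrying \<open>x\<close> from \<open>a\<close> to
    \<open>b\<close>. As a difference of two indicators it vanishes for \<open>a = b\<close>, which
    starts the induction along a path.\<close>
  define transport where "transport a b x r = (if r = a then x else 0) - (if r = b then x else 0)"
    for a b r :: 'a and x :: 'v
  have flow_arc: "flow (transport a b x)" if "(a, b) \<in> E" for a b x
    unfolding flow_def
  \<comment> \<open>The flow carries \<open>x\<close> on the arc and \<open>- x\<close> on its
    reverse, which is an arc by symmetry.\<close>
  proof (intro exI[of _ "\<lambda>r s. (if r = a \<and> s = b then x else 0) - (if r = b \<and> s = a then x else 0)"]
      conjI allI ballI)
    fix r assume "r \<in> R"
    have arc: "(\<Sum>s\<in>E `` {r}. if r = a' \<and> s = b' then x else 0) = (if r = a' then x else 0)"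
      if "(a', b') \<in> E" for a' b'
    proof (cases "r = a'")
      case True
      then have "b' \<in> E `` {r}" using that by simp
      then show ?thesis using True finE[of r] by (simp only: simp_thms sum.delta if_True)
    qed simp
    have "(b, a) \<in> E" using that sym by (rule symD[rotated])
    show "(\<Sum>s\<in>E `` {r}. (if r = a \<and> s = b then x else 0)
        - (if r = b \<and> s = a then x else 0)) = transport a b x r"
      unfolding sum_subtractf transport_def arc[OF \<open>(a, b) \<in> E\<close>] arc[OF \<open>(b, a) \<in> E\<close>] ..
  qed (simp add: conj_commute)
  have flow_transport: "flow (transport a b x)" if "(a, b) \<in> E\<^sup>*" for a b x
    using that
  proof (induction rule: rtrancl_induct)
    case base
    have "transport a a x = (\<lambda>_. 0)" by (simp add: transport_def fun_eq_iff)
    then show ?case using flow_0 by simp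
  next
    case (step b d)
    have "transport a d x = (\<lambda>r. transport a b x r + transport b d x r)"
      by (auto simp: transport_def)
    with flow_add[OF step.IH flow_arc[OF step.hyps(2)]] show ?case by simp
  qed
  have "flow q"
  proof (cases "R = {}")
    case True
    then show ?thesis unfolding flow_def by (intro exI[of _ "\<lambda>_ _. 0"]) simp
  next
    case False
    then obtain r0 where r0: "r0 \<in> R" by blast
    \<comment> \<open>Away from \<open>r0\<close> only the transport from \<open>r\<close>
      contributes. At \<open>r0\<close> the subtracted terms add up to the whole sum of
      \<open>q\<close>, which is zero.\<close>
    have *: "(\<Sum>a\<in>R. transport a r0 (q a) r) = q r" if "r \<in> R" for r
      using that fin q by (cases "r = r0") (simp_all add: transport_def sum_subtractf)
    have "flow (\<lambda>r. \<Sum>a\<in>R. transport a r0 (q a) r)"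
      by (intro flow_sum flow_transport conn r0 fin)
    then show ?thesis
      unfolding flow_def using * by simp
  qed
  then obtain l where "\<forall>r s. l r s + l s r = 0" "\<forall>r\<in>R. (\<Sum>s\<in>E `` {r}. l r s) = q r"
    unfolding flow_def by blast
  moreover from this(1) have "l s r = - l r s" for r s
    by (simp add: eq_neg_iff_add_eq_0)
  ultimately show ?thesis using that by blast
qed

section \<open>Convergence of the alternating direction method\<close>

definition subgradient :: "('v::real_inner \<Rightarrow> real) \<Rightarrow> 'v \<Rightarrow> 'v \<Rightarrow> bool" where
  "subgradient h x g \<longleftrightarrow> (\<forall>w. h w \<ge> h x + g \<bullet> (w - x))"

text \<open>Adding the two subgradient inequalities cancels the values of \<open>h\<close>. The
  common factor \<open>t\<close>, which will be \<open>card R\<close>, is divided out.\<close>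

lemma subgradient_monotone:
  assumes "t > 0" "subgradient h x (t *\<^sub>R g)" "subgradient h x' (t *\<^sub>R g')"
  shows "(g - g') \<bullet> (x - x') \<ge> 0"
proof -
  have "h x' \<ge> h x + t * (g \<bullet> (x' - x))" "h x \<ge> h x' + t * (g' \<bullet> (x - x'))"
    using assms by (auto simp: subgradient_def)
  then have "t * ((g - g') \<bullet> (x - x')) \<ge> 0" by (simp add: inner_diff algebra_simps)
  then show ?thesis using assms(1) by (simp add: zero_le_mult_iff)
qed

text \<open>With a new iterate \<open>x\<close>, an old iterate \<open>y\<close> and a reference
  point \<open>z\<close>, this trades the inner product of error and step for a difference of
  squared errors plus the squared step.\<close>

lemma norm_three_point:
  fixes x y z :: "'v::real_inner"
  shows "(norm (x - z))\<^sup>2 + (norm (x - y))\<^sup>2 = (norm (y - z))\<^sup>2 + 2 * ((x - z) \<bullet> (x - y))"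
  by (simp add: power2_norm_eq_inner inner_diff inner_commute)

text \<open>Subsequences are extracted for one index at a time; the earlier indices keep converging
  under each refinement.\<close>

lemma simultaneous_convergent_subsequence:
  fixes f :: "'i \<Rightarrow> nat \<Rightarrow> 'v::heine_borel"
  assumes "finite I" "\<And>i. i \<in> I \<Longrightarrow> bounded (range (f i))"
  obtains s :: "nat \<Rightarrow> nat" where "strict_mono s" "\<And>i. i \<in> I \<Longrightarrow> convergent (\<lambda>j. f i (s j))"
proof -
  have "\<exists>s::nat \<Rightarrow> nat. strict_mono s \<and> (\<forall>i\<in>I. convergent (\<lambda>j. f i (s j)))"
    using assms
  proof (induction I rule: finite_induct)
    case empty
    then show ?case using strict_mono_id by auto
  next
    case (insert i I)
    then obtain s :: "nat \<Rightarrow> nat" where s: "strict_mono s" "\<forall>i\<in>I. convergent (\<lambda>j. f i (s j))"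
      by auto
    have "bounded (range (f i \<circ> s))"
      using insert.prems by (rule bounded_subset) auto
    then obtain l t where t: "strict_mono (t :: nat \<Rightarrow> nat)" "((f i \<circ> s) \<circ> t) \<longlonglongrightarrow> l"
      using bounded_imp_convergent_subsequence by blast
    have "convergent (\<lambda>j. f i' ((s \<circ> t) j))" if "i' \<in> insert i I" for i'
    proof (cases "i' = i")
      case True
      then show ?thesis using t(2) by (auto simp: convergent_def o_def)
    next
      case False
      then have "convergent (\<lambda>j. f i' (s j))" using that s by auto
      from convergent_subseq_convergent[OF this t(1)] show ?thesis by (simp add: o_def)
    qed
    moreover have "strict_mono (s \<circ> t)" using s t by (simp add: strict_mono_o)
    ultimately show ?case by blast
  qed
  then show ?thesis using that by blast
qed

text \<open>The subgradient relation has a closed graph, so a limit of iterates inherits their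
  optimality conditions.\<close>

lemma subgradient_limit:
  assumes "continuous_on UNIV h" "x \<longlonglongrightarrow> x'" "g \<longlonglongrightarrow> g'" "\<And>j::nat. subgradient h (x j) (g j)"
  shows "subgradient h x' g'"
  unfolding subgradient_def
proof
  fix w
  have "(\<lambda>j. h (x j)) \<longlonglongrightarrow> h x'"
    using continuous_on_tendsto_compose[OF assms(1,2)] by simp
  then have "(\<lambda>j. h (x j) + g j \<bullet> (w - x j)) \<longlonglongrightarrow> h x' + g' \<bullet> (w - x')"
    by (intro tendsto_intros assms(2,3))
  then show "h x' + g' \<bullet> (w - x') \<le> h w"
    by (rule LIMSEQ_le_const2) (use assms(4) in \<open>auto simp: subgradient_def\<close>)
qed

lemma tendsto_zero_if_sq_le:
  fixes x :: "nat \<Rightarrow> 'v::real_normed_vector"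
  assumes "a > 0" "d \<longlonglongrightarrow> 0" "\<And>k. a * (norm (x k))\<^sup>2 \<le> d k"
  shows "x \<longlonglongrightarrow> 0"
proof -
  have lim: "(\<lambda>k. d k / a) \<longlonglongrightarrow> 0"
    using tendsto_divide[OF assms(2) tendsto_const, of a] assms(1) by simp
  have "norm ((norm (x k))\<^sup>2) \<le> d k / a" for k
    using assms(1) assms(3)[of k] by (simp add: field_simps)
  then have "(\<lambda>k. (norm (x k))\<^sup>2) \<longlonglongrightarrow> 0"
    by (intro Lim_null_comparison[OF _ lim] always_eventually allI)
  then have "(\<lambda>k. sqrt ((norm (x k))\<^sup>2)) \<longlonglongrightarrow> sqrt 0" by (rule tendsto_real_sqrt)
  then show ?thesis by (simp add: tendsto_norm_zero_iff)
qed

lemma bounded_if_sq_le: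
  fixes x :: "nat \<Rightarrow> 'v::real_normed_vector"
  assumes "a > 0" "\<And>k. a * (norm (x k - y))\<^sup>2 \<le> d"
  shows "bounded (range x)"
proof -
  have "norm (x k) \<le> norm y + sqrt (d / a)" for k
  proof -
    have "(norm (x k - y))\<^sup>2 \<le> d / a"
      using assms(1) assms(2)[of k] by (simp add: field_simps)
    then have "norm (x k - y) \<le> sqrt (d / a)" by (rule real_le_rsqrt)
    then show ?thesis using norm_triangle_sub[of "x k" y] by linarith
  qed
  then show ?thesis by (auto simp: bounded_iff)
qed

text \<open>
  Here \<open>l r s\<close> is the multiplier of the constraint that \<open>r\<close> and \<open>s\<close> agree; the multipliers of the
  paper are the divergences \<open>p r = (\<Sum>s\<in>E `` {r}. l r s)\<close>.  Keeping the edge multipliers makes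
  the Lyapunov function a plain sum of squares, without a pseudo-inverse of the graph Laplacian.
\<close>

locale consensus_admm =
  fixes R :: "'a set" and E :: "('a \<times> 'a) set" and c :: real
    and H :: "'a \<Rightarrow> 'v::euclidean_space \<Rightarrow> 'v" and b :: "'a \<Rightarrow> 'v" and h :: "'v \<Rightarrow> real"
    and \<zeta> \<gamma> v :: "'a \<Rightarrow> nat \<Rightarrow> 'v" and l :: "'a \<Rightarrow> 'a \<Rightarrow> nat \<Rightarrow> 'v"
  assumes finite_R: "finite R" and nonempty_R: "R \<noteq> {}"
    and arcs: "E \<subseteq> R \<times> R" and sym_arcs: "sym E"
    and conn: "\<And>r s. r \<in> R \<Longrightarrow> s \<in> R \<Longrightarrow> (r, s) \<in> E\<^sup>*"
    and c_pos: "c > 0"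
    and lin: "\<And>r. linear (H r)" and psd: "\<And>r x. H r x \<bullet> x \<ge> 0"
    and cont: "continuous_on UNIV h"
    and v_eq: "\<And>r k. r \<in> R \<Longrightarrow> v r k = H r (\<gamma> r k) - b r"
    and v_Suc: "\<And>r k. r \<in> R \<Longrightarrow> v r (Suc k) = v r k + c *\<^sub>R (\<zeta> r (Suc k) - \<gamma> r (Suc k))"
    and l_antisym: "\<And>r s k. l s r k = - l r s k"
    and l_Suc: "\<And>r s k. l r s (Suc k) = l r s k + c *\<^sub>R (\<zeta> r (Suc k) - \<zeta> s (Suc k))"
    and zeta_subgradient: "\<And>r k. r \<in> R \<Longrightarrow> subgradient h (\<zeta> r (Suc k))
      (real (card R) *\<^sub>R (c *\<^sub>R (\<gamma> r k - \<gamma> r (Suc k)) - v r (Suc k) - (\<Sum>s\<in>E `` {r}. l r s (Suc k))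
        + c *\<^sub>R (\<Sum>s\<in>E `` {r}. \<zeta> r k + \<zeta> s k - \<zeta> r (Suc k) - \<zeta> s (Suc k))))"
begin

section \<open>Saddle points and the Lyapunov function\<close>

lemma card_R_pos: "real (card R) > 0"
  using finite_R nonempty_R by (simp add: card_gt_0_iff)

lemma finite_arcs: "finite E"
  using finite_R arcs by (meson finite_SigmaI finite_subset)

text \<open>The optimality system for minimizing the sum over agents of loss plus
  \<open>h / card R\<close> under agreement along arcs, where \<open>H r z - b r\<close> is the
  gradient of the loss of \<open>r\<close>. The factor \<open>card R\<close> turns a subgradient of
  the agent's share into one of \<open>h\<close>.\<close>

definition saddle :: "'v \<Rightarrow> ('a \<Rightarrow> 'a \<Rightarrow> 'v) \<Rightarrow> bool" where
  "saddle z m \<longleftrightarrow> (\<forall>r s. m s r = - m r s) \<and>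
    (\<forall>r\<in>R. subgradient h z (real (card R) *\<^sub>R (- (H r z - b r) - (\<Sum>s\<in>E `` {r}. m r s))))"

text \<open>An edge occurs as two opposite arcs, hence the halved weights \<open>1 / (2 * c)\<close>
  and \<open>c / 2\<close>. The iterates \<open>\<zeta>\<close> enter only through sums over the
  ends of arcs: half such a sum plays the role of an auxiliary edge variable.\<close>

definition lyapunov :: "'v \<Rightarrow> ('a \<Rightarrow> 'a \<Rightarrow> 'v) \<Rightarrow> nat \<Rightarrow> real" where
  "lyapunov z m k =
    (\<Sum>r\<in>R. (1 / c) * (norm (v r k - (H r z - b r)))\<^sup>2 + c * (norm (\<gamma> r k - z))\<^sup>2) +
    (\<Sum>(r, s)\<in>E. (1 / (2 * c)) * (norm (l r s k - m r s))\<^sup>2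
       + (c / 2) * (norm (\<zeta> r k + \<zeta> s k - 2 *\<^sub>R z))\<^sup>2)"

definition decrement :: "nat \<Rightarrow> real" where
  "decrement k =
    (\<Sum>r\<in>R. (1 / c) * (norm (v r (Suc k) - v r k))\<^sup>2 + c * (norm (\<gamma> r (Suc k) - \<gamma> r k))\<^sup>2) +
    (\<Sum>(r, s)\<in>E. (1 / (2 * c)) * (norm (l r s (Suc k) - l r s k))\<^sup>2
       + (c / 2) * (norm ((\<zeta> r (Suc k) + \<zeta> s (Suc k)) - (\<zeta> r k + \<zeta> s k)))\<^sup>2)"

section \<open>The one-step descent inequality\<close>

lemma saddle_antisym: "saddle z m \<Longrightarrow> m s r = - m r s"
  unfolding saddle_def by (drule conjunct1) (elim allE)

lemma saddle_subgradient: "saddle z m \<Longrightarrow> r \<in> R \<Longrightarrow>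
    subgradient h z (real (card R) *\<^sub>R (- (H r z - b r) - (\<Sum>s\<in>E `` {r}. m r s)))"
  unfolding saddle_def by (drule conjunct2) (elim bspec)

text \<open>Three monotonicity facts combine: that of the subgradients of \<open>h\<close> between
  iterate and saddle point, and that of \<open>H r\<close>, once for the error of
  \<open>\<gamma>\<close> and once for its step.\<close>

lemma agent_inequality:
  assumes "saddle z m" "r \<in> R"
  shows "(\<Sum>s\<in>E `` {r}. (l r s (Suc k) - m r s) \<bullet> (\<zeta> r (Suc k) - z))
    + (1 / c) * ((v r (Suc k) - (H r z - b r)) \<bullet> (v r (Suc k) - v r k))
    + c * ((\<gamma> r (Suc k) - z) \<bullet> (\<gamma> r (Suc k) - \<gamma> r k))
    \<le> c * (\<Sum>s\<in>E `` {r}. (\<zeta> r k + \<zeta> s k - \<zeta> r (Suc k) - \<zeta> s (Suc k)) \<bullet> (\<zeta> r (Suc k) - z))"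
proof -
  define V where "V = v r (Suc k) - (H r z - b r)"
  define D where "D = v r (Suc k) - v r k"
  define L where "L = (\<Sum>s\<in>E `` {r}. l r s (Suc k) - m r s)"
  define Q where "Q = (\<Sum>s\<in>E `` {r}. \<zeta> r k + \<zeta> s k - \<zeta> r (Suc k) - \<zeta> s (Suc k))"
  define e where "e = \<gamma> r (Suc k) - z"
  define d where "d = \<gamma> r (Suc k) - \<gamma> r k"
  have "V = H r e"
    using assms(2) lin[of r] by (simp add: V_def e_def v_eq linear_diff)
  then have mono1: "V \<bullet> e \<ge> 0" using psd by simp
  have "D = H r d"
    using assms(2) lin[of r] by (simp add: D_def d_def v_eq linear_diff)
  then have mono2: "D \<bullet> d \<ge> 0" using psd by simp
  \<comment> \<open>The update of \<open>v\<close> expresses \<open>\<zeta>\<close> through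
    \<open>\<gamma>\<close> and the step of \<open>v\<close>. This splits the products of
    \<open>V\<close> and \<open>d\<close> with \<open>\<zeta> r (Suc k) - z\<close> into a term of
    the claim and a term that is nonnegative by \<open>mono1\<close> or
    \<open>mono2\<close>.\<close>
  have zeta: "\<zeta> r (Suc k) - z = e + (1 / c) *\<^sub>R D"
  proof -
    have "D = c *\<^sub>R (\<zeta> r (Suc k) - \<gamma> r (Suc k))"
      unfolding D_def using v_Suc[OF assms(2), of k] by (metis add_diff_cancel_left')
    then show ?thesis using c_pos by (simp add: e_def)
  qed
  from subgradient_monotone[OF card_R_pos zeta_subgradient[OF assms(2), of k]
      saddle_subgradient[OF assms]]
  have "(c *\<^sub>R (\<gamma> r k - \<gamma> r (Suc k)) - v r (Suc k) - (\<Sum>s\<in>E `` {r}. l r s (Suc k))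
        + c *\<^sub>R Q - (- (H r z - b r) - (\<Sum>s\<in>E `` {r}. m r s))) \<bullet> (\<zeta> r (Suc k) - z) \<ge> 0"
    unfolding Q_def .
  also have "c *\<^sub>R (\<gamma> r k - \<gamma> r (Suc k)) - v r (Suc k) - (\<Sum>s\<in>E `` {r}. l r s (Suc k))
        + c *\<^sub>R Q - (- (H r z - b r) - (\<Sum>s\<in>E `` {r}. m r s)) = - c *\<^sub>R d - V - L + c *\<^sub>R Q"
    by (simp add: d_def V_def L_def sum_subtractf algebra_simps)
  finally have "L \<bullet> (\<zeta> r (Suc k) - z) + V \<bullet> (\<zeta> r (Suc k) - z) + c * (d \<bullet> (\<zeta> r (Suc k) - z))
      \<le> c * (Q \<bullet> (\<zeta> r (Suc k) - z))"
    by (simp add: inner_diff_left inner_add_left)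
  moreover have "V \<bullet> (\<zeta> r (Suc k) - z) = V \<bullet> e + (1 / c) * (V \<bullet> D)"
    unfolding zeta by (simp add: inner_add_right)
  moreover have "c * (d \<bullet> (\<zeta> r (Suc k) - z)) = c * (e \<bullet> d) + D \<bullet> d"
    unfolding zeta using c_pos by (simp add: inner_add_right inner_commute algebra_simps)
  ultimately show ?thesis
    using mono1 mono2
    by (simp add: L_def Q_def V_def D_def e_def d_def inner_sum_left)
qed

text \<open>The agent inequalities are summed and each arc is paired with its reverse. What remains
  are products of errors with steps, which \<open>norm_three_point\<close> converts into squared
  distances.\<close>

lemma descent:
  assumes "saddle z m"
  shows "lyapunov z m (Suc k) + decrement k \<le> lyapunov z m k"
proof -
  define S where "S r s k = \<zeta> r k + \<zeta> s k" for r s k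
  have antisym: "m s r = - m r s" for r s using assms by (rule saddle_antisym)
  let ?a = "\<lambda>r. (1 / c) * ((v r (Suc k) - (H r z - b r)) \<bullet> (v r (Suc k) - v r k))
    + c * ((\<gamma> r (Suc k) - z) \<bullet> (\<gamma> r (Suc k) - \<gamma> r k))"
  let ?L = "\<lambda>r s. (1 / (2 * c)) * ((l r s (Suc k) - m r s) \<bullet> (l r s (Suc k) - l r s k))"
  let ?S = "\<lambda>r s. (c / 2) * ((S r s (Suc k) - 2 *\<^sub>R z) \<bullet> (S r s (Suc k) - S r s k))"
  let ?f = "\<lambda>r s. (l r s (Suc k) - m r s) \<bullet> (\<zeta> r (Suc k) - z)"
  let ?g = "\<lambda>r s. (\<zeta> r k + \<zeta> s k - \<zeta> r (Suc k) - \<zeta> s (Suc k)) \<bullet> (\<zeta> r (Suc k) - z)"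
  have "(\<Sum>r\<in>R. (\<Sum>s\<in>E `` {r}. ?f r s) + ?a r) \<le> (\<Sum>r\<in>R. c * (\<Sum>s\<in>E `` {r}. ?g r s))"
    by (intro sum_mono) (use agent_inequality[OF assms, of _ k] in \<open>simp add: add.assoc\<close>)
  then have main: "(\<Sum>(r, s)\<in>E. ?f r s) + sum ?a R \<le> c * (\<Sum>(r, s)\<in>E. ?g r s)"
    by (simp add: sum.distrib sum_neighbors_eq_sum_arcs[OF finite_R arcs] flip: sum_distrib_left)
  \<comment> \<open>By antisymmetry an arc and its reverse together pair the multiplier error with
    the difference of the ends, which is the multiplier step divided by \<open>c\<close>.\<close>
  have fL: "?f r s + ?f s r = 2 * ?L r s" for r s
  proof -
    have "?f s r = - ((l r s (Suc k) - m r s) \<bullet> (\<zeta> s (Suc k) - z))"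
      by (simp add: l_antisym[of s r] antisym[of s r] inner_diff_left)
    moreover have "l r s (Suc k) - l r s k = c *\<^sub>R (\<zeta> r (Suc k) - \<zeta> s (Suc k))"
      by (simp add: l_Suc)
    ultimately show ?thesis
      using c_pos by (simp add: inner_diff_right)
  qed
  have "2 * (\<Sum>(r, s)\<in>E. ?f r s) = (\<Sum>(r, s)\<in>E. ?f r s) + (\<Sum>(r, s)\<in>E. ?f s r)"
    by (subst (2) sum_arcs_swap[OF sym_arcs]) simp
  also have "\<dots> = (\<Sum>(r, s)\<in>E. ?f r s + ?f s r)"
    by (simp add: split_def sum.distrib)
  also have "\<dots> = 2 * (\<Sum>(r, s)\<in>E. ?L r s)"
    by (simp add: fL sum_distrib_left split_def)
  finally have f: "(\<Sum>(r, s)\<in>E. ?f r s) = (\<Sum>(r, s)\<in>E. ?L r s)" by simp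
  \<comment> \<open>The sum over the ends is symmetric in \<open>r\<close> and \<open>s\<close>, so
    an arc and its reverse together pair the step of this sum with its own error.\<close>
  have gS: "c * (?g r s + ?g s r) = - 2 * ?S r s" for r s
    by (simp add: S_def inner_diff inner_add algebra_simps inner_commute)
  have "2 * (c * (\<Sum>(r, s)\<in>E. ?g r s)) = c * ((\<Sum>(r, s)\<in>E. ?g r s) + (\<Sum>(r, s)\<in>E. ?g s r))"
    by (subst (2) sum_arcs_swap[OF sym_arcs]) simp
  also have "\<dots> = (\<Sum>(r, s)\<in>E. c * (?g r s + ?g s r))"
    by (simp add: split_def sum.distrib sum_distrib_left distrib_left)
  also have "\<dots> = - 2 * (\<Sum>(r, s)\<in>E. ?S r s)"
    by (simp only: gS sum_distrib_left split_def)
  finally have g: "c * (\<Sum>(r, s)\<in>E. ?g r s) = - (\<Sum>(r, s)\<in>E. ?S r s)" by simp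
  have tp: "t * (norm (x - w))\<^sup>2 + t * (norm (x - y))\<^sup>2 = t * (norm (y - w))\<^sup>2 + 2 * (t * ((x - w) \<bullet> (x - y)))"
    for t and x y w :: 'v
    using norm_three_point[of x w y] by (metis distrib_left mult.left_commute)
  have agents: "(\<Sum>r\<in>R. (1 / c) * (norm (v r (Suc k) - (H r z - b r)))\<^sup>2 + c * (norm (\<gamma> r (Suc k) - z))\<^sup>2)
    + (\<Sum>r\<in>R. (1 / c) * (norm (v r (Suc k) - v r k))\<^sup>2 + c * (norm (\<gamma> r (Suc k) - \<gamma> r k))\<^sup>2)
    = (\<Sum>r\<in>R. (1 / c) * (norm (v r k - (H r z - b r)))\<^sup>2 + c * (norm (\<gamma> r k - z))\<^sup>2) + 2 * sum ?a R"
    unfolding sum_distrib_left sum.distrib[symmetric]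
  proof (rule sum.cong)
    fix r assume "r \<in> R"
    show "(1 / c) * (norm (v r (Suc k) - (H r z - b r)))\<^sup>2 + c * (norm (\<gamma> r (Suc k) - z))\<^sup>2
      + ((1 / c) * (norm (v r (Suc k) - v r k))\<^sup>2 + c * (norm (\<gamma> r (Suc k) - \<gamma> r k))\<^sup>2)
      = (1 / c) * (norm (v r k - (H r z - b r)))\<^sup>2 + c * (norm (\<gamma> r k - z))\<^sup>2 + 2 * ?a r"
      using tp[of "1/c" "v r (Suc k)" "H r z - b r" "v r k"] tp[of c "\<gamma> r (Suc k)" z "\<gamma> r k"]
      by argo
  qed simp
  have arcs: "(\<Sum>(r, s)\<in>E. (1 / (2 * c)) * (norm (l r s (Suc k) - m r s))\<^sup>2
       + (c / 2) * (norm (S r s (Suc k) - 2 *\<^sub>R z))\<^sup>2)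
    + (\<Sum>(r, s)\<in>E. (1 / (2 * c)) * (norm (l r s (Suc k) - l r s k))\<^sup>2
       + (c / 2) * (norm (S r s (Suc k) - S r s k))\<^sup>2)
    = (\<Sum>(r, s)\<in>E. (1 / (2 * c)) * (norm (l r s k - m r s))\<^sup>2
       + (c / 2) * (norm (S r s k - 2 *\<^sub>R z))\<^sup>2)
    + 2 * ((\<Sum>(r, s)\<in>E. ?L r s) + (\<Sum>(r, s)\<in>E. ?S r s))"
    unfolding split_def sum_distrib_left sum.distrib[symmetric]
  proof (rule sum.cong)
    fix e :: "'a \<times> 'a"
    obtain r s where e: "e = (r, s)" by (cases e)
    show "(1 / (2 * c)) * (norm (l (fst e) (snd e) (Suc k) - m (fst e) (snd e)))\<^sup>2
       + (c / 2) * (norm (S (fst e) (snd e) (Suc k) - 2 *\<^sub>R z))\<^sup>2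
      + ((1 / (2 * c)) * (norm (l (fst e) (snd e) (Suc k) - l (fst e) (snd e) k))\<^sup>2
       + (c / 2) * (norm (S (fst e) (snd e) (Suc k) - S (fst e) (snd e) k))\<^sup>2)
     = (1 / (2 * c)) * (norm (l (fst e) (snd e) k - m (fst e) (snd e)))\<^sup>2
       + (c / 2) * (norm (S (fst e) (snd e) k - 2 *\<^sub>R z))\<^sup>2
       + 2 * (?L (fst e) (snd e) + ?S (fst e) (snd e))"
      unfolding e fst_conv snd_conv
      using tp[of "1/(2*c)" "l r s (Suc k)" "m r s" "l r s k"]
        tp[of "c/2" "S r s (Suc k)" "2 *\<^sub>R z" "S r s k"]
      by argo
  qed simp
  \<comment> \<open>This is half the total excess in the identities \<open>agents\<close> and
    \<open>arcs\<close>.\<close>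
  have le: "sum ?a R + ((\<Sum>(r, s)\<in>E. ?L r s) + (\<Sum>(r, s)\<in>E. ?S r s)) \<le> 0"
    using main unfolding f g by linarith
  have "(A' + B') + (D + D') \<le> A + B"
    if "A' + D = A + 2 * a" "B' + D' = B + 2 * e" "a + e \<le> 0" for A A' B B' D D' a e :: real
    using that by linarith
  from this[OF agents arcs le] show ?thesis
    unfolding lyapunov_def decrement_def S_def .
qed

section \<open>Single terms bounded by the Lyapunov function and its decrement\<close>

lemma agent_le_lyapunov:
  assumes "r \<in> R"
  shows "c * (norm (\<gamma> r k - z))\<^sup>2 \<le> lyapunov z m k"
proof -
  let ?f = "\<lambda>r. (1 / c) * (norm (v r k - (H r z - b r)))\<^sup>2 + c * (norm (\<gamma> r k - z))\<^sup>2"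
  have "c * (norm (\<gamma> r k - z))\<^sup>2 \<le> ?f r" using c_pos by simp
  also have "\<dots> \<le> sum ?f R"
    using c_pos by (intro member_le_sum assms finite_R) simp
  also have "\<dots> \<le> lyapunov z m k"
    using c_pos by (simp add: lyapunov_def) (auto intro!: sum_nonneg)
  finally show ?thesis .
qed

lemma arc_le_lyapunov:
  assumes "(r, s) \<in> E"
  shows "1 / (2 * c) * (norm (l r s k - m r s))\<^sup>2 \<le> lyapunov z m k"
proof -
  let ?f = "\<lambda>(r, s). (1 / (2 * c)) * (norm (l r s k - m r s))\<^sup>2
       + (c / 2) * (norm (\<zeta> r k + \<zeta> s k - 2 *\<^sub>R z))\<^sup>2"
  have "1 / (2 * c) * (norm (l r s k - m r s))\<^sup>2 \<le> ?f (r, s)" using c_pos by simp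
  also have "\<dots> \<le> sum ?f E"
    using c_pos by (intro member_le_sum assms finite_arcs) auto
  also have "\<dots> \<le> lyapunov z m k"
    using c_pos by (simp add: lyapunov_def) (auto intro!: sum_nonneg)
  finally show ?thesis .
qed

lemma agent_le_decrement:
  assumes "r \<in> R"
  shows "(1 / c) * (norm (v r (Suc k) - v r k))\<^sup>2 \<le> decrement k"
    and "c * (norm (\<gamma> r (Suc k) - \<gamma> r k))\<^sup>2 \<le> decrement k"
proof -
  let ?f = "\<lambda>r. (1 / c) * (norm (v r (Suc k) - v r k))\<^sup>2 + c * (norm (\<gamma> r (Suc k) - \<gamma> r k))\<^sup>2"
  have "?f r \<le> sum ?f R"
    using c_pos by (intro member_le_sum assms finite_R) simp
  also have "\<dots> \<le> decrement k"
    using c_pos by (simp add: decrement_def) (auto intro!: sum_nonneg)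
  finally have "?f r \<le> decrement k" .
  moreover have "(1 / c) * (norm (v r (Suc k) - v r k))\<^sup>2 \<ge> 0" "c * (norm (\<gamma> r (Suc k) - \<gamma> r k))\<^sup>2 \<ge> 0"
    using c_pos by auto
  ultimately show "(1 / c) * (norm (v r (Suc k) - v r k))\<^sup>2 \<le> decrement k"
    and "c * (norm (\<gamma> r (Suc k) - \<gamma> r k))\<^sup>2 \<le> decrement k"
    by linarith+
qed

lemma arc_le_decrement:
  assumes "(r, s) \<in> E"
  shows "1 / (2 * c) * (norm (l r s (Suc k) - l r s k))\<^sup>2 \<le> decrement k"
    and "c / 2 * (norm ((\<zeta> r (Suc k) + \<zeta> s (Suc k)) - (\<zeta> r k + \<zeta> s k)))\<^sup>2 \<le> decrement k"
proof -
  let ?g = "\<lambda>r s. 1 / (2 * c) * (norm (l r s (Suc k) - l r s k))\<^sup>2"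
  let ?h = "\<lambda>r s. c / 2 * (norm ((\<zeta> r (Suc k) + \<zeta> s (Suc k)) - (\<zeta> r k + \<zeta> s k)))\<^sup>2"
  have "(\<lambda>(r, s). ?g r s + ?h r s) (r, s) \<le> (\<Sum>(r, s)\<in>E. ?g r s + ?h r s)"
    using c_pos by (intro member_le_sum assms finite_arcs) auto
  also have "\<dots> \<le> decrement k"
    using c_pos by (simp add: decrement_def) (auto intro!: sum_nonneg)
  finally have "?g r s + ?h r s \<le> decrement k" by simp
  moreover have "?g r s \<ge> 0" "?h r s \<ge> 0"
    using c_pos by auto
  ultimately show "?g r s \<le> decrement k" "?h r s \<le> decrement k"
    by linarith+
qed

lemma lyapunov_nonneg: "lyapunov z m k \<ge> 0"
  unfolding lyapunov_def using c_pos by (intro add_nonneg_nonneg sum_nonneg) auto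

lemma decrement_nonneg: "decrement k \<ge> 0"
  unfolding decrement_def using c_pos by (intro add_nonneg_nonneg sum_nonneg) auto

lemma lyapunov_decseq:
  assumes "saddle z m"
  shows "decseq (lyapunov z m)"
  unfolding decseq_Suc_iff
proof
  fix k
  show "lyapunov z m (Suc k) \<le> lyapunov z m k"
    using descent[OF assms, of k] decrement_nonneg[of k] by linarith
qed

lemma lyapunov_convergent:
  assumes "saddle z m"
  obtains L where "lyapunov z m \<longlonglongrightarrow> L"
  by (rule decseq_convergent[OF lyapunov_decseq[OF assms], of 0]) (simp_all add: lyapunov_nonneg that)

text \<open>By \<open>descent\<close> the decrement lies between zero and the difference of
  consecutive values of a convergent sequence.\<close>

lemma decrement_tendsto_0:
  assumes "saddle z m"
  shows "decrement \<longlonglongrightarrow> 0"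
proof -
  obtain L where L: "lyapunov z m \<longlonglongrightarrow> L"
    using lyapunov_convergent[OF assms] .
  then have "(\<lambda>k. lyapunov z m k - lyapunov z m (Suc k)) \<longlonglongrightarrow> L - L"
    by (intro tendsto_diff LIMSEQ_Suc)
  then have lim: "(\<lambda>k. lyapunov z m k - lyapunov z m (Suc k)) \<longlonglongrightarrow> 0" by simp
  have "norm (decrement k) \<le> lyapunov z m k - lyapunov z m (Suc k)" for k
    using descent[OF assms, of k] decrement_nonneg[of k] by simp
  then show ?thesis
    by (intro Lim_null_comparison[OF _ lim] always_eventually allI)
qed

section \<open>Saddle points and optimality for the summed cost\<close>

lemma sum_saddle_multipliers:
  assumes "saddle z m"
  shows "(\<Sum>r\<in>R. \<Sum>s\<in>E `` {r}. m r s) = 0"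
proof -
  have "(\<Sum>(r, s)\<in>E. m r s) = (\<Sum>(r, s)\<in>E. m s r)"
    by (rule sum_arcs_swap[OF sym_arcs])
  also have "\<dots> = (\<Sum>(r, s)\<in>E. - m r s)"
    unfolding split_def by (intro sum.cong refl saddle_antisym[OF assms])
  also have "\<dots> = - (\<Sum>(r, s)\<in>E. m r s)"
    by (simp add: split_def sum_negf)
  finally have "(\<Sum>(r, s)\<in>E. m r s) = 0"
    by (simp only: eq_neg_iff_add_eq_0 flip: scaleR_2) simp
  then show ?thesis
    by (simp only: sum_neighbors_eq_sum_arcs[OF finite_R arcs])
qed

text \<open>Summing the inequalities over the agents cancels the multipliers and leaves
  \<open>card R\<close> copies of one inequality.\<close>

lemma saddle_imp_optimal:
  assumes "saddle z m"
  shows "subgradient h z (- (\<Sum>r\<in>R. H r z - b r))"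
  unfolding subgradient_def
proof
  fix w
  let ?g = "\<lambda>r. - (H r z - b r) - (\<Sum>s\<in>E `` {r}. m r s)"
  have "h z + real (card R) * (?g r \<bullet> (w - z)) \<le> h w" if "r \<in> R" for r
    using saddle_subgradient[OF assms that] by (simp add: subgradient_def)
  then have "(\<Sum>r\<in>R. h z + real (card R) * (?g r \<bullet> (w - z))) \<le> (\<Sum>r\<in>R. h w)"
    by (rule sum_mono)
  then have "real (card R) * (h z + (\<Sum>r\<in>R. ?g r) \<bullet> (w - z)) \<le> real (card R) * h w"
    by (simp only: sum.distrib sum_constant of_nat_mult distrib_left inner_sum_left sum_distrib_left)
  moreover have "(\<Sum>r\<in>R. ?g r) = - (\<Sum>r\<in>R. H r z - b r)"
    using sum_saddle_multipliers[OF assms] by (simp add: sum_subtractf sum_negf)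
  ultimately show "h z + - (\<Sum>r\<in>R. H r z - b r) \<bullet> (w - z) \<le> h w"
    by (simp only: mult_le_cancel_left_pos[OF card_R_pos])
qed

lemma optimal_imp_saddle:
  assumes "subgradient h z (- (\<Sum>r\<in>R. H r z - b r))"
  obtains m where "saddle z m"
proof -
  define g where "g = - (\<Sum>r\<in>R. H r z - b r)"
  \<comment> \<open>The divergence that gives every agent the same vector \<open>g\<close> in its
    saddle condition. It sums to zero because the gradients sum to \<open>- g\<close>.\<close>
  define q where "q r = - (H r z - b r) - (1 / real (card R)) *\<^sub>R g" for r
  have "sum q R = (\<Sum>r\<in>R. - (H r z - b r)) - (\<Sum>r\<in>R. (1 / real (card R)) *\<^sub>R g)"
    unfolding q_def by (rule sum_subtractf)
  also have "(\<Sum>r\<in>R. - (H r z - b r)) = g"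
    unfolding g_def by (rule sum_negf)
  also have "(\<Sum>r\<in>R. (1 / real (card R)) *\<^sub>R g) = g"
    using card_R_pos by (simp add: sum_constant_scaleR del: sum_constant)
  finally have "sum q R = 0" by simp
  then obtain m where antisym: "\<And>r s. m s r = - m r s"
    and m: "\<And>r. r \<in> R \<Longrightarrow> (\<Sum>s\<in>E `` {r}. m r s) = q r"
    using antisymmetric_flow_exists[OF finite_R arcs sym_arcs conn, of q] by blast
  have "real (card R) *\<^sub>R (- (H r z - b r) - (\<Sum>s\<in>E `` {r}. m r s)) = g" if "r \<in> R" for r
    using m[OF that] card_R_pos by (simp add: q_def)
  then have "saddle z m"
    unfolding saddle_def using assms[folded g_def] by (intro conjI allI ballI antisym) simp
  then show ?thesis by (rule that)
qed

section \<open>Convergence of the whole sequence to one saddle point\<close>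

theorem convergence:
  assumes "subgradient h z0 (- (\<Sum>r\<in>R. H r z0 - b r))"
  obtains z where "subgradient h z (- (\<Sum>r\<in>R. H r z - b r))" "\<And>r. r \<in> R \<Longrightarrow> \<zeta> r \<longlonglongrightarrow> z"
proof -
  \<comment> \<open>This saddle point serves to bound the iterates and to make the steps vanish; the
    limit may be a different one.\<close>
  obtain m0 where m0: "saddle z0 m0" using optimal_imp_saddle[OF assms] .
  have dec: "lyapunov z0 m0 k \<le> lyapunov z0 m0 0" for k
    using lyapunov_decseq[OF m0] by (simp add: decseq_def)
  note d0 = decrement_tendsto_0[OF m0]
  have dv: "(\<lambda>k. v r (Suc k) - v r k) \<longlonglongrightarrow> 0" if "r \<in> R" for r
    using c_pos agent_le_decrement(1)[OF that] by (intro tendsto_zero_if_sq_le[OF _ d0, of "1 / c"]) auto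
  have d\<gamma>: "(\<lambda>k. \<gamma> r (Suc k) - \<gamma> r k) \<longlonglongrightarrow> 0" if "r \<in> R" for r
    using c_pos agent_le_decrement(2)[OF that] by (intro tendsto_zero_if_sq_le[OF _ d0, of c]) auto
  have dl: "(\<lambda>k. l r s (Suc k) - l r s k) \<longlonglongrightarrow> 0" if "(r, s) \<in> E" for r s
    using c_pos arc_le_decrement(1)[OF that] by (intro tendsto_zero_if_sq_le[OF _ d0, of "1 / (2 * c)"]) auto
  have d\<zeta>: "(\<lambda>k. (\<zeta> r (Suc k) + \<zeta> s (Suc k)) - (\<zeta> r k + \<zeta> s k)) \<longlonglongrightarrow> 0" if "(r, s) \<in> E" for r s
    using c_pos arc_le_decrement(2)[OF that] by (intro tendsto_zero_if_sq_le[OF _ d0, of "c / 2"]) auto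
  have \<zeta>\<gamma>: "(\<lambda>k. \<zeta> r (Suc k) - \<gamma> r (Suc k)) \<longlonglongrightarrow> 0" if "r \<in> R" for r
  proof -
    have "(\<lambda>k. (1 / c) *\<^sub>R (v r (Suc k) - v r k)) \<longlonglongrightarrow> (1 / c) *\<^sub>R 0"
      by (intro tendsto_intros dv that)
    moreover have "(1 / c) *\<^sub>R (v r (Suc k) - v r k) = \<zeta> r (Suc k) - \<gamma> r (Suc k)" for k
      unfolding v_Suc[OF that] using c_pos by simp
    ultimately show ?thesis by simp
  qed
  have "bounded (range (\<gamma> r))" if "r \<in> R" for r
    using c_pos order.trans[OF agent_le_lyapunov[OF that] dec] by (rule bounded_if_sq_le)
  moreover have "bounded (range (l r s))" if "(r, s) \<in> E" for r s
    using _ order.trans[OF arc_le_lyapunov[OF that] dec] by (rule bounded_if_sq_le) (use c_pos in simp)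
  \<comment> \<open>Agents and arcs form one finite index set, so that one subsequence serves all
    \<open>\<gamma> r\<close> and \<open>l r s\<close>. The limits of \<open>\<zeta>\<close> and
    \<open>v\<close> follow from those of \<open>\<gamma>\<close>.\<close>
  ultimately have "bounded (range (case_sum \<gamma> (\<lambda>(r, s). l r s) i))" if "i \<in> R <+> E" for i
    using that by auto
  then obtain \<sigma> :: "nat \<Rightarrow> nat" where \<sigma>: "strict_mono \<sigma>"
    and conv: "\<And>i. i \<in> R <+> E \<Longrightarrow> convergent (\<lambda>j. case_sum \<gamma> (\<lambda>(r, s). l r s) i (\<sigma> j))"
    using simultaneous_convergent_subsequence[OF finite_Plus[OF finite_R finite_arcs]] by metis
  define \<gamma>' where "\<gamma>' r = lim (\<lambda>j. \<gamma> r (\<sigma> j))" for r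
  \<comment> \<open>The value zero off the arcs makes \<open>m\<close> antisymmetric on all pairs,
    as \<open>saddle\<close> demands.\<close>
  define m where "m r s = (if (r, s) \<in> E then lim (\<lambda>j. l r s (\<sigma> j)) else 0)" for r s
  have sub: "(\<lambda>j. f (\<sigma> j)) \<longlonglongrightarrow> a" if "f \<longlonglongrightarrow> a" for f :: "nat \<Rightarrow> 'b::topological_space" and a
    using LIMSEQ_subseq_LIMSEQ[OF that \<sigma>] by (simp add: o_def)
  have \<gamma>0: "(\<lambda>j. \<gamma> r (\<sigma> j)) \<longlonglongrightarrow> \<gamma>' r" if "r \<in> R" for r
    using conv[of "Inl r"] that by (simp add: \<gamma>'_def convergent_LIMSEQ_iff InlI)
  have l0: "(\<lambda>j. l r s (\<sigma> j)) \<longlonglongrightarrow> m r s" if "(r, s) \<in> E" for r s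
    using conv[of "Inr (r, s)"] that by (simp add: m_def convergent_LIMSEQ_iff InrI)
  \<comment> \<open>The optimality conditions mix times \<open>k\<close> and \<open>Suc k\<close>;
    vanishing steps give both the same limits along \<open>\<sigma>\<close>.\<close>
  have \<gamma>1: "(\<lambda>j. \<gamma> r (Suc (\<sigma> j))) \<longlonglongrightarrow> \<gamma>' r" if "r \<in> R" for r
    using tendsto_add[OF sub[OF d\<gamma>[OF that]] \<gamma>0[OF that]] by simp
  have l1: "(\<lambda>j. l r s (Suc (\<sigma> j))) \<longlonglongrightarrow> m r s" if "(r, s) \<in> E" for r s
    using tendsto_add[OF sub[OF dl[OF that]] l0[OF that]] by simp
  have \<zeta>1: "(\<lambda>j. \<zeta> r (Suc (\<sigma> j))) \<longlonglongrightarrow> \<gamma>' r" if "r \<in> R" for r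
    using tendsto_add[OF sub[OF \<zeta>\<gamma>[OF that]] \<gamma>1[OF that]] by simp
  \<comment> \<open>The multiplier step is \<open>c\<close> times the disagreement of the ends, so
    the limits agree along arcs and, by connectedness, on all of \<open>R\<close>.\<close>
  have arc: "\<gamma>' r = \<gamma>' s" if "(r, s) \<in> E" for r s
  proof -
    have "(\<lambda>j. \<zeta> r (Suc (\<sigma> j)) - \<zeta> s (Suc (\<sigma> j))) \<longlonglongrightarrow> \<gamma>' r - \<gamma>' s"
      by (intro tendsto_diff \<zeta>1) (use that arcs in auto)
    moreover have "(\<lambda>j. (1 / c) *\<^sub>R (l r s (Suc (\<sigma> j)) - l r s (\<sigma> j))) \<longlonglongrightarrow> (1 / c) *\<^sub>R 0"
      by (intro tendsto_intros sub dl that)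
    then have "(\<lambda>j. \<zeta> r (Suc (\<sigma> j)) - \<zeta> s (Suc (\<sigma> j))) \<longlonglongrightarrow> 0"
      using c_pos by (simp add: l_Suc)
    ultimately show ?thesis using LIMSEQ_unique by fastforce
  qed
  have path: "\<gamma>' r = \<gamma>' s" if "(r, s) \<in> E\<^sup>*" for r s
    using that by (induction rule: rtrancl_induct) (simp_all add: arc)
  obtain r0 where r0: "r0 \<in> R" using nonempty_R by blast
  define z where "z = \<gamma>' r0"
  have z: "\<gamma>' r = z" if "r \<in> R" for r
    unfolding z_def by (rule path) (rule conn[OF that r0])
  have v1: "(\<lambda>j. v r (Suc (\<sigma> j))) \<longlonglongrightarrow> H r z - b r" if "r \<in> R" for r
  proof -
    have "bounded_linear (H r)" using lin[of r] by (simp only: linear_conv_bounded_linear)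
    from bounded_linear.tendsto[OF this \<gamma>1[OF that]] show ?thesis
      unfolding v_eq[OF that] z[OF that] by (intro tendsto_diff tendsto_const)
  qed
  have antisym: "m s r = - m r s" for r s
  proof (cases "(r, s) \<in> E")
    case True
    then have "(s, r) \<in> E" using sym_arcs by (rule symD[rotated])
    then have "(\<lambda>j. - l r s (\<sigma> j)) \<longlonglongrightarrow> m s r"
      using l0[of s r] by (simp only: l_antisym[of s r])
    moreover have "(\<lambda>j. - l r s (\<sigma> j)) \<longlonglongrightarrow> - m r s"
      using l0[OF True] by (rule tendsto_minus)
    ultimately show ?thesis by (rule LIMSEQ_unique)
  next
    case False
    then have "(s, r) \<notin> E" using sym_arcs by (blast dest: symD)
    then show ?thesis using False by (simp add: m_def)
  qed
  have "subgradient h z (real (card R) *\<^sub>R (- (H r z - b r) - (\<Sum>s\<in>E `` {r}. m r s)))"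
    if r: "r \<in> R" for r
  proof (rule subgradient_limit[OF cont _ _ zeta_subgradient[OF r]])
    show "(\<lambda>j. \<zeta> r (Suc (\<sigma> j))) \<longlonglongrightarrow> z" using \<zeta>1 z r by metis
    \<comment> \<open>Up to sign this is the step of the sum over the ends of an arc.\<close>
    have "(\<lambda>j. \<zeta> r (\<sigma> j) + \<zeta> s (\<sigma> j) - \<zeta> r (Suc (\<sigma> j)) - \<zeta> s (Suc (\<sigma> j))) \<longlonglongrightarrow> 0"
      if "s \<in> E `` {r}" for s
      using tendsto_minus[OF sub[OF d\<zeta>[of r s]]] that by (simp add: algebra_simps)
    moreover have "(\<lambda>j. \<gamma> r (\<sigma> j) - \<gamma> r (Suc (\<sigma> j))) \<longlonglongrightarrow> 0"
      using tendsto_minus[OF sub[OF d\<gamma>[OF r]]] by simp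
    ultimately have "(\<lambda>j. real (card R) *\<^sub>R (c *\<^sub>R (\<gamma> r (\<sigma> j) - \<gamma> r (Suc (\<sigma> j))) - v r (Suc (\<sigma> j))
          - (\<Sum>s\<in>E `` {r}. l r s (Suc (\<sigma> j)))
          + c *\<^sub>R (\<Sum>s\<in>E `` {r}. \<zeta> r (\<sigma> j) + \<zeta> s (\<sigma> j) - \<zeta> r (Suc (\<sigma> j)) - \<zeta> s (Suc (\<sigma> j)))))
        \<longlonglongrightarrow> real (card R) *\<^sub>R (c *\<^sub>R 0 - (H r z - b r) - (\<Sum>s\<in>E `` {r}. m r s)
          + c *\<^sub>R (\<Sum>s\<in>E `` {r}. 0))"
      using v1[OF r] l1 by (intro tendsto_intros) auto
    then show "(\<lambda>j. real (card R) *\<^sub>R (c *\<^sub>R (\<gamma> r (\<sigma> j) - \<gamma> r (Suc (\<sigma> j))) - v r (Suc (\<sigma> j))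
          - (\<Sum>s\<in>E `` {r}. l r s (Suc (\<sigma> j)))
          + c *\<^sub>R (\<Sum>s\<in>E `` {r}. \<zeta> r (\<sigma> j) + \<zeta> s (\<sigma> j) - \<zeta> r (Suc (\<sigma> j)) - \<zeta> s (Suc (\<sigma> j)))))
        \<longlonglongrightarrow> real (card R) *\<^sub>R (- (H r z - b r) - (\<Sum>s\<in>E `` {r}. m r s))"
      by simp
  qed
  then have m: "saddle z m" unfolding saddle_def by (intro conjI allI ballI antisym)
  \<comment> \<open>The Lyapunov function is now taken relative to the limit \<open>(z, m)\<close>.
    It tends to zero along the subsequence and, being convergent, tends to zero altogether.\<close>
  have "(\<lambda>j. lyapunov z m (Suc (\<sigma> j))) \<longlonglongrightarrow>
    (\<Sum>r\<in>R. (1 / c) * (norm ((H r z - b r) - (H r z - b r)))\<^sup>2 + c * (norm (z - z))\<^sup>2) +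
    (\<Sum>(r, s)\<in>E. (1 / (2 * c)) * (norm (m r s - m r s))\<^sup>2
       + (c / 2) * (norm (z + z - 2 *\<^sub>R z))\<^sup>2)"
    unfolding lyapunov_def split_def
  proof (intro tendsto_add tendsto_sum tendsto_mult tendsto_const tendsto_power tendsto_norm tendsto_diff)
    fix e assume e: "e \<in> E"
    then have "fst e \<in> R" "snd e \<in> R" using arcs by auto
    then show "(\<lambda>j. \<zeta> (fst e) (Suc (\<sigma> j))) \<longlonglongrightarrow> z" "(\<lambda>j. \<zeta> (snd e) (Suc (\<sigma> j))) \<longlonglongrightarrow> z"
      using \<zeta>1 z by metis+
    show "(\<lambda>j. l (fst e) (snd e) (Suc (\<sigma> j))) \<longlonglongrightarrow> m (fst e) (snd e)"
      using l1 e by simp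
  qed (use v1 \<gamma>1 z in auto)
  then have "(\<lambda>j. lyapunov z m (Suc (\<sigma> j))) \<longlonglongrightarrow> 0"
    by (simp add: scaleR_2)
  moreover obtain L where L: "lyapunov z m \<longlonglongrightarrow> L" using lyapunov_convergent[OF m] .
  ultimately have lim: "lyapunov z m \<longlonglongrightarrow> 0"
    using LIMSEQ_unique sub[OF LIMSEQ_Suc[OF L]] by metis
  have limit: "\<zeta> r \<longlonglongrightarrow> z" if r: "r \<in> R" for r
  proof -
    \<comment> \<open>The Lyapunov function bounds the error of \<open>\<gamma> r\<close>; that of
      \<open>\<zeta> r\<close> follows because \<open>\<zeta> r - \<gamma> r\<close> vanishes in the
      limit.\<close>
    have "(\<lambda>k. \<gamma> r k - z) \<longlonglongrightarrow> 0"
      using c_pos lim agent_le_lyapunov[OF r] by (rule tendsto_zero_if_sq_le)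
    then have "(\<lambda>k. \<gamma> r (Suc k) - z) \<longlonglongrightarrow> 0"
      by (rule LIMSEQ_Suc)
    from tendsto_add[OF \<zeta>\<gamma>[OF r] this] have "(\<lambda>k. \<zeta> r (Suc k) - z) \<longlonglongrightarrow> 0" by simp
    then show ?thesis by (rule LIMSEQ_imp_Suc[OF LIM_zero_cancel])
  qed
  show ?thesis by (rule that[OF saddle_imp_optimal[OF m] limit])
qed

end

section \<open>The group penalty and its subgradients\<close>

lemma linear_subvec: "linear (subvec A)"
  by (rule linearI) (auto simp: subvec_def vec_eq_iff)

lemma subvec_simps [simp]:
  "subvec A (x + y) = subvec A x + subvec A y"
  "subvec A (x - y) = subvec A x - subvec A y"
  "subvec A (t *\<^sub>R x) = t *\<^sub>R subvec A x"
  "subvec A (\<Sum>i\<in>I. f i) = (\<Sum>i\<in>I. subvec A (f i))"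
  by (simp_all add: linear_add linear_diff linear_scale linear_sum linear_subvec)

lemma inner_subvec: "subvec A x \<bullet> subvec A y = (\<Sum>i\<in>A. x $ i * y $ i)"
proof -
  have "subvec A x \<bullet> subvec A y = (\<Sum>i\<in>UNIV. if i \<in> A then x $ i * y $ i else 0)"
    by (auto simp: inner_vec_def subvec_def intro!: sum.cong)
  then show ?thesis by (simp add: sum.If_cases)
qed

lemma inner_eq_sum_subvec:
  fixes x y :: "real ^ 'p::finite"
  assumes "disjoint_family_on B {1..Nb}" "(\<Union>\<nu>\<in>{1..Nb}. B \<nu>) = UNIV"
  shows "x \<bullet> y = (\<Sum>\<nu>\<in>{1..Nb::nat}. subvec (B \<nu>) x \<bullet> subvec (B \<nu>) y)"
proof -
  have "x \<bullet> y = (\<Sum>i\<in>(\<Union>\<nu>\<in>{1..Nb}. B \<nu>). x $ i * y $ i)"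
    unfolding assms(2) by (simp add: inner_vec_def)
  also have "\<dots> = (\<Sum>\<nu>\<in>{1..Nb}. \<Sum>i\<in>B \<nu>. x $ i * y $ i)"
    using assms(1) by (intro sum.UNION_disjoint_family) simp_all
  finally show ?thesis by (simp add: inner_subvec)
qed

lemma sum_subvec_eq:
  fixes x :: "real ^ 'p::finite"
  assumes "disjoint_family_on B {1..Nb}" "(\<Union>\<nu>\<in>{1..Nb}. B \<nu>) = UNIV"
  shows "(\<Sum>\<nu>\<in>{1..Nb::nat}. subvec (B \<nu>) x) = x"
proof -
  have "y \<bullet> subvec A x = subvec A y \<bullet> subvec A x" for y and A :: "'p set"
  proof -
    have "y \<bullet> subvec A x = (\<Sum>i\<in>UNIV. if i \<in> A then y $ i * x $ i else 0)"
      by (auto simp: inner_vec_def subvec_def intro!: sum.cong)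
    then show ?thesis by (simp add: sum.If_cases inner_subvec)
  qed
  then have "y \<bullet> (\<Sum>\<nu>\<in>{1..Nb}. subvec (B \<nu>) x) = y \<bullet> x" for y
    by (simp add: inner_sum_right inner_eq_sum_subvec[OF assms, of y x])
  then show ?thesis using vector_eq_ldot by blast
qed

text \<open>The residual is the projection of \<open>a\<close> onto the ball of radius
  \<open>\<mu>\<close>. The two facts say that it is a subgradient of \<open>\<mu>\<close> times the
  norm at the thresholded vector.\<close>

lemma soft_threshold_residual:
  fixes a :: "'v::real_inner"
  assumes "\<mu> \<ge> 0"
  shows "norm (a - soft_threshold \<mu> a) \<le> \<mu>"
    and "(a - soft_threshold \<mu> a) \<bullet> soft_threshold \<mu> a = \<mu> * norm (soft_threshold \<mu> a)"
proof -
  have "norm (a - soft_threshold \<mu> a) \<le> \<mu> \<and>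
    (a - soft_threshold \<mu> a) \<bullet> soft_threshold \<mu> a = \<mu> * norm (soft_threshold \<mu> a)"
  proof (cases "norm a \<le> \<mu>")
    case True
    then have "soft_threshold \<mu> a = 0" by (simp add: soft_threshold_def)
    then show ?thesis using True by simp
  next
    case False
    then have pos: "norm a > 0" using assms by linarith
    have T: "soft_threshold \<mu> a = ((norm a - \<mu>) / norm a) *\<^sub>R a"
      using False by (simp add: soft_threshold_def)
    have "a - soft_threshold \<mu> a = (1 - (norm a - \<mu>) / norm a) *\<^sub>R a"
      unfolding T by (simp add: scaleR_left_diff_distrib)
    also have "1 - (norm a - \<mu>) / norm a = \<mu> / norm a"
      using pos by (simp add: field_simps)
    finally have D: "a - soft_threshold \<mu> a = (\<mu> / norm a) *\<^sub>R a" .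
    have "norm (soft_threshold \<mu> a) = norm a - \<mu>"
      unfolding T using pos False by simp
    moreover have "(a - soft_threshold \<mu> a) \<bullet> soft_threshold \<mu> a = \<mu> * (norm a - \<mu>)"
      unfolding D unfolding T using pos
      by (simp add: power2_norm_eq_inner[symmetric] power2_eq_square)
    moreover have "norm (a - soft_threshold \<mu> a) = \<mu>"
      unfolding D using pos assms by simp
    ultimately show ?thesis by simp
  qed
  then show "norm (a - soft_threshold \<mu> a) \<le> \<mu>"
    and "(a - soft_threshold \<mu> a) \<bullet> soft_threshold \<mu> a = \<mu> * norm (soft_threshold \<mu> a)"
    by auto
qed

definition group_penalty :: "real \<Rightarrow> nat \<Rightarrow> (nat \<Rightarrow> 'p set) \<Rightarrow> real ^ 'p::finite \<Rightarrow> real" where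
  "group_penalty \<mu> Nb B z = \<mu> * (\<Sum>\<nu>\<in>{1..Nb}. norm (subvec (B \<nu>) z))"

lemma continuous_on_group_penalty: "continuous_on S (group_penalty \<mu> Nb B)"
proof -
  have "continuous_on S (subvec A)" for A
    by (rule linear_continuous_on) (simp add: linear_subvec flip: linear_conv_bounded_linear)
  then show ?thesis
    unfolding group_penalty_def[abs_def] by (intro continuous_intros)
qed

lemma group_penalty_convex:
  assumes "\<mu> \<ge> 0" "0 \<le> t" "t \<le> 1"
  shows "group_penalty \<mu> Nb B (z + t *\<^sub>R (w - z))
    \<le> (1 - t) * group_penalty \<mu> Nb B z + t * group_penalty \<mu> Nb B w"
proof -
  have "norm (subvec (B \<nu>) (z + t *\<^sub>R (w - z)))
      \<le> (1 - t) * norm (subvec (B \<nu>) z) + t * norm (subvec (B \<nu>) w)" for \<nu>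
  proof -
    have "subvec (B \<nu>) (z + t *\<^sub>R (w - z)) = (1 - t) *\<^sub>R subvec (B \<nu>) z + t *\<^sub>R subvec (B \<nu>) w"
      by (simp add: algebra_simps)
    then show ?thesis
      using norm_triangle_ineq[of "(1 - t) *\<^sub>R subvec (B \<nu>) z" "t *\<^sub>R subvec (B \<nu>) w"] assms
      by simp
  qed
  then have "(\<Sum>\<nu>\<in>{1..Nb}. norm (subvec (B \<nu>) (z + t *\<^sub>R (w - z))))
      \<le> (\<Sum>\<nu>\<in>{1..Nb}. (1 - t) * norm (subvec (B \<nu>) z) + t * norm (subvec (B \<nu>) w))"
    by (intro sum_mono)
  also have "\<dots> = (1 - t) * (\<Sum>\<nu>\<in>{1..Nb}. norm (subvec (B \<nu>) z))
      + t * (\<Sum>\<nu>\<in>{1..Nb}. norm (subvec (B \<nu>) w))"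
    by (simp only: sum.distrib sum_distrib_left)
  finally have "group_penalty \<mu> Nb B (z + t *\<^sub>R (w - z)) \<le> \<mu> * \<dots>"
    unfolding group_penalty_def using assms(1) by (rule mult_left_mono)
  then show ?thesis by (simp add: group_penalty_def algebra_simps)
qed

text \<open>The triangle inequality over the blocks; it makes the cost coercive for
  \<open>\<mu> > 0\<close>.\<close>

lemma norm_le_group_penalty:
  assumes "disjoint_family_on B {1..Nb}" "(\<Union>\<nu>\<in>{1..Nb}. B \<nu>) = UNIV" "\<mu> \<ge> 0"
  shows "\<mu> * norm z \<le> group_penalty \<mu> Nb B z"
proof -
  have "norm z \<le> (\<Sum>\<nu>\<in>{1..Nb}. norm (subvec (B \<nu>) z))"
    using norm_sum[of "\<lambda>\<nu>. subvec (B \<nu>) z" "{1..Nb}"] by (simp only: sum_subvec_eq[OF assms(1,2)])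
  then show ?thesis
    unfolding group_penalty_def using assms(3) by (rule mult_left_mono)
qed

text \<open>Soft thresholding is the proximal map of the norm, and scaling a point by
  \<open>t > 0\<close> does not change the subgradients of a norm there. The blocks of
  \<open>g\<close> have norm at most \<open>\<mu>\<close>, so \<open>g \<bullet> w\<close> never
  exceeds the penalty at \<open>w\<close>, with equality at \<open>x\<close>.\<close>

lemma soft_threshold_step_subgradient:
  assumes part: "disjoint_family_on B {1..Nb}" "(\<Union>\<nu>\<in>{1..Nb}. B \<nu>) = UNIV"
    and "\<mu> \<ge> 0" "t > 0"
    and step: "\<And>\<nu>. \<nu> \<in> {1..Nb} \<Longrightarrow>
      subvec (B \<nu>) x = (1 / t) *\<^sub>R soft_threshold \<mu> (subvec (B \<nu>) a)"
  shows "subgradient (group_penalty \<mu> Nb B) x (a - t *\<^sub>R x)"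
  unfolding subgradient_def
proof
  fix w
  define g where "g = a - t *\<^sub>R x"
  have g: "subvec (B \<nu>) g = subvec (B \<nu>) a - soft_threshold \<mu> (subvec (B \<nu>) a)"
    if "\<nu> \<in> {1..Nb}" for \<nu>
    using step[OF that] assms(4) by (simp add: g_def)
  have "g \<bullet> w \<le> (\<Sum>\<nu>\<in>{1..Nb}. \<mu> * norm (subvec (B \<nu>) w))"
    unfolding inner_eq_sum_subvec[OF part, of g w]
  proof (rule sum_mono)
    fix \<nu> assume "\<nu> \<in> {1..Nb}"
    then have "norm (subvec (B \<nu>) g) \<le> \<mu>"
      using soft_threshold_residual(1)[OF assms(3)] by (simp only: g)
    then have "norm (subvec (B \<nu>) g) * norm (subvec (B \<nu>) w) \<le> \<mu> * norm (subvec (B \<nu>) w)"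
      by (rule mult_right_mono) simp
    then show "subvec (B \<nu>) g \<bullet> subvec (B \<nu>) w \<le> \<mu> * norm (subvec (B \<nu>) w)"
      using norm_cauchy_schwarz[of "subvec (B \<nu>) g" "subvec (B \<nu>) w"] by linarith
  qed
  moreover have "g \<bullet> x = (\<Sum>\<nu>\<in>{1..Nb}. \<mu> * norm (subvec (B \<nu>) x))"
    unfolding inner_eq_sum_subvec[OF part, of g x]
  proof (rule sum.cong)
    fix \<nu> assume "\<nu> \<in> {1..Nb}"
    then show "subvec (B \<nu>) g \<bullet> subvec (B \<nu>) x = \<mu> * norm (subvec (B \<nu>) x)"
      unfolding g[OF \<open>\<nu> \<in> {1..Nb}\<close>] step[OF \<open>\<nu> \<in> {1..Nb}\<close>]
      using soft_threshold_residual(2)[OF assms(3), of "subvec (B \<nu>) a"] assms(4) by simp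
  qed simp
  ultimately show "group_penalty \<mu> Nb B x + (a - t *\<^sub>R x) \<bullet> (w - x) \<le> group_penalty \<mu> Nb B w"
    unfolding g_def[symmetric] by (simp add: group_penalty_def sum_distrib_left inner_diff_right)
qed

section \<open>The least-squares loss\<close>

lemma mat_mult_vec_eq_inner: "mat_mult_vec X z i = X i \<bullet> z"
  by (simp add: mat_mult_vec_def inner_vec_def)

lemma gram_mult_vec: "gram m X *v z = (\<Sum>i<m. (X i \<bullet> z) *\<^sub>R X i)"
proof -
  have "(\<Sum>l\<in>UNIV. (\<Sum>i<m. X i $ j * X i $ l) * z $ l) = (\<Sum>i<m. (X i \<bullet> z) * X i $ j)" for j
  proof -
    have "(\<Sum>l\<in>UNIV. (\<Sum>i<m. X i $ j * X i $ l) * z $ l)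
        = (\<Sum>i<m. \<Sum>l\<in>UNIV. X i $ j * X i $ l * z $ l)"
      by (subst sum.swap) (simp add: sum_distrib_right)
    also have "\<dots> = (\<Sum>i<m. (X i \<bullet> z) * X i $ j)"
      by (simp add: inner_vec_def sum_distrib_left sum_distrib_right mult_ac)
    finally show ?thesis .
  qed
  then show ?thesis
    by (simp add: vec_eq_iff gram_def matrix_vector_mult_def)
qed

lemma inner_gram: "(gram m X *v z) \<bullet> w = (\<Sum>i<m. (X i \<bullet> z) * (X i \<bullet> w))"
  by (simp add: gram_mult_vec inner_sum_left)

lemma inner_transpose_mult_vec: "transpose_mult_vec m X y \<bullet> w = (\<Sum>i<m. y i * (X i \<bullet> w))"
proof -
  have "transpose_mult_vec m X y = (\<Sum>i<m. y i *\<^sub>R X i)"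
    by (simp add: transpose_mult_vec_def vec_eq_iff mult.commute)
  then show ?thesis by (simp add: inner_sum_left)
qed

text \<open>\<open>matrix_inv\<close> chooses a two-sided inverse, so one must exist: a trivial
  kernel gives a left inverse, which is two-sided for a square matrix.\<close>

lemma matrix_inv_mult_vec:
  fixes A :: "real ^ 'n ^ 'n"
  assumes "\<And>x. A *v x = 0 \<Longrightarrow> x = 0"
  shows "A *v (matrix_inv A *v u) = u"
proof -
  have "\<exists>A'. A' ** A = mat 1"
    unfolding matrix_left_invertible_ker using assms by blast
  then have "\<exists>A'. A ** A' = mat 1 \<and> A' ** A = mat 1"
    using matrix_left_right_inverse by blast
  then have "A ** matrix_inv A = mat 1"
    unfolding matrix_inv_def by (rule someI2_ex) simp
  then show ?thesis by (simp add: matrix_vector_mul_assoc)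
qed

text \<open>The matrix is positive definite: its quadratic form is \<open>c\<close> times the
  squared norm plus a sum of squares. Hence its kernel is trivial.\<close>

lemma regularized_gram_solve:
  assumes "c > 0" "x = matrix_inv (c *\<^sub>R mat 1 + gram m X) *v u"
  shows "c *\<^sub>R x + gram m X *v x = u"
proof -
  have mult: "(c *\<^sub>R mat 1 + gram m X) *v z = c *\<^sub>R z + gram m X *v z" for z
    by (simp add: matrix_vector_mult_add_rdistrib scaleR_matrix_vector_assoc[symmetric])
  have ker: "z = 0" if "(c *\<^sub>R mat 1 + gram m X) *v z = 0" for z
  proof -
    have "c * (z \<bullet> z) + (\<Sum>i<m. (X i \<bullet> z) * (X i \<bullet> z)) = (c *\<^sub>R z + gram m X *v z) \<bullet> z"
      by (simp add: inner_add_left inner_gram)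
    also have "\<dots> = 0" using that by (simp add: mult)
    finally have "c * (z \<bullet> z) \<le> 0"
      using sum_nonneg[of "{..<m}" "\<lambda>i. (X i \<bullet> z) * (X i \<bullet> z)"] by simp
    then have "z \<bullet> z \<le> 0" using assms(1) by (simp add: mult_le_0_iff)
    then show ?thesis by (meson inner_gt_zero_iff not_le)
  qed
  have "(c *\<^sub>R mat 1 + gram m X) *v x = u"
    unfolding assms(2) by (rule matrix_inv_mult_vec) (rule ker)
  then show ?thesis by (simp only: mult)
qed

text \<open>The exact second-order expansion of the quadratic loss about \<open>z\<close>; both
  directions of the optimality criterion rest on it.\<close>

lemma glasso_cost_difference:
  "glasso_cost R \<mu> Nb B n X y w = glasso_cost R \<mu> Nb B n X y z
    + (\<Sum>r\<in>R. gram (n r) (X r) *v z - transpose_mult_vec (n r) (X r) (y r)) \<bullet> (w - z)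
    + 1 / 2 * (\<Sum>r\<in>R. \<Sum>i<n r. (X r i \<bullet> (w - z))\<^sup>2)
    + group_penalty \<mu> Nb B w - group_penalty \<mu> Nb B z"
proof -
  have "1 / 2 * (\<Sum>i<n r. (y r i - X r i \<bullet> w)\<^sup>2) = 1 / 2 * (\<Sum>i<n r. (y r i - X r i \<bullet> z)\<^sup>2)
      + (gram (n r) (X r) *v z - transpose_mult_vec (n r) (X r) (y r)) \<bullet> (w - z)
      + 1 / 2 * (\<Sum>i<n r. (X r i \<bullet> (w - z))\<^sup>2)" for r
    unfolding inner_diff_left inner_gram inner_transpose_mult_vec sum_distrib_left
      sum_subtractf[symmetric] sum.distrib[symmetric]
    by (rule sum.cong) (simp_all add: inner_diff_right power2_eq_square field_simps)
  then have "(\<Sum>r\<in>R. 1 / 2 * (\<Sum>i<n r. (y r i - X r i \<bullet> w)\<^sup>2))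
      = (\<Sum>r\<in>R. 1 / 2 * (\<Sum>i<n r. (y r i - X r i \<bullet> z)\<^sup>2))
      + (\<Sum>r\<in>R. (gram (n r) (X r) *v z - transpose_mult_vec (n r) (X r) (y r)) \<bullet> (w - z))
      + (\<Sum>r\<in>R. 1 / 2 * (\<Sum>i<n r. (X r i \<bullet> (w - z))\<^sup>2))"
    by (simp only: sum.distrib)
  then show ?thesis
    unfolding glasso_cost_def sq_norm_def mat_mult_vec_eq_inner group_penalty_def
      sum_distrib_left[symmetric] inner_sum_left by linarith
qed

lemma optimal_imp_arg_min:
  assumes "subgradient (group_penalty \<mu> Nb B) z
    (- (\<Sum>r\<in>R. gram (n r) (X r) *v z - transpose_mult_vec (n r) (X r) (y r)))"
  shows "is_arg_min (glasso_cost R \<mu> Nb B n X y) (\<lambda>_. True) z"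
proof -
  have "glasso_cost R \<mu> Nb B n X y z \<le> glasso_cost R \<mu> Nb B n X y w" for w
  proof -
    have "(\<Sum>r\<in>R. \<Sum>i<n r. (X r i \<bullet> (w - z))\<^sup>2) \<ge> 0"
      by (intro sum_nonneg) simp
    moreover have "group_penalty \<mu> Nb B z
        - (\<Sum>r\<in>R. gram (n r) (X r) *v z - transpose_mult_vec (n r) (X r) (y r)) \<bullet> (w - z)
        \<le> group_penalty \<mu> Nb B w"
      using assms[unfolded subgradient_def, THEN spec, of w] unfolding inner_minus_left by linarith
    ultimately show ?thesis
      unfolding glasso_cost_difference[of R \<mu> Nb B n X y w z] by linarith
  qed
  then show ?thesis by (simp add: is_arg_min_def not_less)
qed

text \<open>On the segment from \<open>z\<close> to \<open>w\<close>, the expansion of the loss and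
  the convexity of the penalty give \<open>t * (a + t * q) \<ge> 0\<close>. Dividing by
  \<open>t\<close> and letting \<open>t\<close> tend to zero leaves \<open>a \<ge> 0\<close>, the
  claim.\<close>

lemma minimizer_imp_optimal:
  assumes "\<mu> \<ge> 0" "\<And>w. glasso_cost R \<mu> Nb B n X y z \<le> glasso_cost R \<mu> Nb B n X y w"
  shows "subgradient (group_penalty \<mu> Nb B) z
    (- (\<Sum>r\<in>R. gram (n r) (X r) *v z - transpose_mult_vec (n r) (X r) (y r)))"
  unfolding subgradient_def
proof
  fix w
  let ?h = "group_penalty \<mu> Nb B"
  define g where "g = (\<Sum>r\<in>R. gram (n r) (X r) *v z - transpose_mult_vec (n r) (X r) (y r))"
  define a where "a = g \<bullet> (w - z) + ?h w - ?h z"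
  define q where "q = 1 / 2 * (\<Sum>r\<in>R. \<Sum>i<n r. (X r i \<bullet> (w - z))\<^sup>2)"
  have "a + t * q \<ge> 0" if t: "0 < t" "t \<le> 1" for t
  proof -
    have "1 / 2 * (\<Sum>r\<in>R. \<Sum>i<n r. (X r i \<bullet> (t *\<^sub>R (w - z)))\<^sup>2) = t\<^sup>2 * q"
      by (simp only: q_def inner_scaleR_right power_mult_distrib sum_distrib_left mult.left_commute)
    then have "0 \<le> t * (g \<bullet> (w - z)) + t\<^sup>2 * q + ?h (z + t *\<^sub>R (w - z)) - ?h z"
      using assms(2)[of "z + t *\<^sub>R (w - z)"]
        glasso_cost_difference[of R \<mu> Nb B n X y "z + t *\<^sub>R (w - z)" z]
      by (simp add: g_def)
    also have "\<dots> \<le> t * (g \<bullet> (w - z)) + t\<^sup>2 * q + ((1 - t) * ?h z + t * ?h w) - ?h z"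
      using group_penalty_convex[of \<mu> t Nb B z w] assms(1) t by simp
    also have "\<dots> = t * (a + t * q)"
      by (simp add: a_def power2_eq_square algebra_simps)
    finally show ?thesis using t(1) by (simp add: zero_le_mult_iff)
  qed
  then have "a + inverse (real (Suc k)) * q \<ge> 0" for k
    by (simp add: inverse_le_1_iff)
  moreover have "(\<lambda>k. a + inverse (real (Suc k)) * q) \<longlonglongrightarrow> a + 0 * q"
    by (intro tendsto_intros LIMSEQ_inverse_real_of_nat)
  ultimately have "a \<ge> 0"
    using LIMSEQ_le_const[of _ "a + 0 * q" 0] by auto
  then show "?h z + - (\<Sum>r\<in>R. gram (n r) (X r) *v z - transpose_mult_vec (n r) (X r) (y r)) \<bullet> (w - z)
      \<le> ?h w"
    unfolding a_def g_def[symmetric] by simp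
qed

section \<open>Existence of a minimizer\<close>

lemma normal_equations_solvable:
  fixes X :: "'a \<Rightarrow> nat \<Rightarrow> real ^ 'p::finite"
  assumes "finite R"
  obtains z where "(\<Sum>r\<in>R. gram (n r) (X r) *v z - transpose_mult_vec (n r) (X r) (y r)) = 0"
proof -
  define f where "f z = (\<Sum>r\<in>R. gram (n r) (X r) *v z)" for z
  define b where "b = (\<Sum>r\<in>R. transpose_mult_vec (n r) (X r) (y r))"
  have "linear f"
    unfolding f_def[abs_def] by (intro linear_compose_sum ballI matrix_vector_mul_linear)
  then have span: "span (range f) = range f"
    by (simp add: linear_subspace_image)
  \<comment> \<open>The part \<open>w\<close> of \<open>b\<close> orthogonal to the range of
    \<open>f\<close> will vanish, which puts \<open>b\<close> into the range.\<close>
  obtain u w where u: "u \<in> span (range f)" and orth: "\<And>x. x \<in> span (range f) \<Longrightarrow> orthogonal w x"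
    and b: "b = u + w"
    using orthogonal_subspace_decomp_exists[of "range f" b] by blast
  \<comment> \<open>The quadratic form of \<open>f\<close> is a sum of squares, so every data row is
    orthogonal to \<open>w\<close>; \<open>b\<close> is a combination of these rows.\<close>
  have "0 = f w \<bullet> w"
    using orth[of "f w"] span by (simp add: orthogonal_def inner_commute)
  also have "\<dots> = (\<Sum>r\<in>R. \<Sum>i<n r. (X r i \<bullet> w)\<^sup>2)"
    by (simp add: f_def inner_sum_left inner_gram power2_eq_square)
  finally have "\<forall>r\<in>R. (\<Sum>i<n r. (X r i \<bullet> w)\<^sup>2) = 0"
    using assms by (simp add: sum_nonneg_eq_0_iff sum_nonneg)
  then have "X r i \<bullet> w = 0" if "r \<in> R" "i < n r" for r i
    using that by (simp add: sum_nonneg_eq_0_iff)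
  then have "b \<bullet> w = 0"
    by (simp add: b_def inner_sum_left inner_transpose_mult_vec)
  moreover have "u \<bullet> w = 0"
    using orth[OF u] by (simp add: orthogonal_def inner_commute)
  ultimately have "w = 0" by (simp add: b inner_add_left)
  then obtain z where "f z = b" using u span b by auto
  then show ?thesis
    using that by (simp add: f_def b_def sum_subtractf)
qed

lemma continuous_on_glasso_cost: "continuous_on S (glasso_cost R \<mu> Nb B n X y)"
proof -
  have "glasso_cost R \<mu> Nb B n X y = (\<lambda>z. 1 / 2 * (\<Sum>r\<in>R. \<Sum>i<n r. (y r i - X r i \<bullet> z)\<^sup>2)
      + group_penalty \<mu> Nb B z)"
    by (simp add: fun_eq_iff glasso_cost_def sq_norm_def mat_mult_vec_eq_inner group_penalty_def)
  then show ?thesis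
    by (auto intro!: continuous_intros continuous_on_group_penalty)
qed

text \<open>
  For \<open>\<mu> > 0\<close> the cost is coercive; for \<open>\<mu> = 0\<close> it need not be, and a minimizer comes from the
  normal equations.
\<close>

lemma optimal_exists:
  fixes X :: "'a \<Rightarrow> nat \<Rightarrow> real ^ 'p::finite"
  assumes part: "disjoint_family_on B {1..Nb}" "(\<Union>\<nu>\<in>{1..Nb}. B \<nu>) = UNIV"
    and "\<mu> \<ge> 0" "finite R"
  obtains z where "subgradient (group_penalty \<mu> Nb B) z
    (- (\<Sum>r\<in>R. gram (n r) (X r) *v z - transpose_mult_vec (n r) (X r) (y r)))"
proof (cases "\<mu> = 0")
  case True
  obtain z where "(\<Sum>r\<in>R. gram (n r) (X r) *v z - transpose_mult_vec (n r) (X r) (y r)) = 0"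
    using normal_equations_solvable[OF assms(4)] .
  then show ?thesis
    using True by (intro that[of z]) (simp add: subgradient_def group_penalty_def)
next
  case False
  then have pos: "\<mu> > 0" using assms(3) by simp
  let ?f = "glasso_cost R \<mu> Nb B n X y"
  \<comment> \<open>Outside the ball of radius \<open>\<rho>\<close> the bound \<open>lower\<close>
    keeps the cost at or above its value at zero, so a minimizer over the ball is global.\<close>
  define \<rho> where "\<rho> = ?f 0 / \<mu>"
  have lower: "\<mu> * norm w \<le> ?f w" for w
  proof -
    have "0 \<le> 1 / 2 * (\<Sum>r\<in>R. sq_norm (n r) (\<lambda>i. y r i - mat_mult_vec (X r) w i))"
      by (simp add: sq_norm_def sum_nonneg)
    then show ?thesis
      using norm_le_group_penalty[OF part assms(3), of w] by (simp add: glasso_cost_def group_penalty_def)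
  qed
  have "\<rho> \<ge> 0" unfolding \<rho>_def using lower[of 0] pos by simp
  then obtain z where z: "z \<in> cball 0 \<rho>" "\<And>w. w \<in> cball 0 \<rho> \<Longrightarrow> ?f z \<le> ?f w"
    using continuous_attains_inf[OF compact_cball _ continuous_on_glasso_cost, of 0 \<rho> R \<mu> Nb B n X y]
    by auto
  have "?f z \<le> ?f w" for w
  proof (cases "norm w \<le> \<rho>")
    case True
    then show ?thesis by (intro z(2)) simp
  next
    case False
    then have "?f 0 \<le> \<mu> * norm w" using pos by (simp add: \<rho>_def field_simps)
    also have "\<dots> \<le> ?f w" by (rule lower)
    finally show ?thesis using z(2)[of 0] \<open>\<rho> \<ge> 0\<close> by simp
  qed
  then show ?thesis by (intro that[of z] minimizer_imp_optimal[OF assms(3)])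
qed

section \<open>The distributed group Lasso\<close>

lemma rtrancl_on_imp_rtrancl: "(a, b) \<in> rtrancl_on F E \<Longrightarrow> (a, b) \<in> E\<^sup>*"
  by (induction rule: rtrancl_on_induct) auto

lemma connected_imp_rtrancl:
  assumes "pair_graph G" "Digraph_Component.connected (with_proj G)" "r \<in> pverts G" "s \<in> pverts G"
  shows "(r, s) \<in> (parcs G)\<^sup>*"
proof -
  interpret pair_graph G by (rule assms(1))
  \<comment> \<open>\<open>connected\<close> refers to the symmetric closure, which has the same
    arcs since the graph is symmetric.\<close>
  have "parcs (mk_symmetric (with_proj G)) = parcs G"
    using adj_mk_symmetric_eq[OF pair_sym_arcs] by simp
  then have "(r, s) \<in> rtrancl_on (pverts G) (parcs G)"
    using assms(2-4) by (auto simp: connected_def strongly_connected_def reachable_def)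
  then show ?thesis by (rule rtrancl_on_imp_rtrancl)
qed

text \<open>The sum of the \<open>p r\<close> is conserved, and a fixed point satisfies the
  optimality condition shifted by this sum; starting from sum zero, it is the group-Lasso condition.
  Minimizers need not be unique, so the limit is one of them, common to all agents.\<close>

theorem proposition3:
  fixes G :: "nat pair_pre_digraph"
    and Nr Nb :: nat
    and \<mu> c :: real
    and B :: "nat \<Rightarrow> 'p::finite set"
    and n :: "nat \<Rightarrow> nat"
    and X :: "nat \<Rightarrow> nat \<Rightarrow> real ^ 'p"
    and y :: "nat \<Rightarrow> nat \<Rightarrow> real"
    and \<zeta> \<gamma> :: "nat \<Rightarrow> nat \<Rightarrow> real ^ 'p"
    and p v :: "nat \<Rightarrow> int \<Rightarrow> real ^ 'p"
  assumes "pair_graph G" and "pverts G = {1..Nr}"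
    and "Digraph_Component.connected (with_proj G)"
    and "disjoint_family_on B {1..Nb}" and "(\<Union>\<nu>\<in>{1..Nb}. B \<nu>) = UNIV"
    and "\<mu> \<ge> 0" and "c > 0"
    and "dglasso_iterates G c \<mu> Nb B n X y \<zeta> \<gamma> p v"
    and "(\<Sum>r\<in>pverts G. p r (-1)) = 0"
  shows "\<exists>z. is_arg_min (glasso_cost (pverts G) \<mu> Nb B n X y) (\<lambda>_. True) z
           \<and> (\<forall>r\<in>pverts G. (\<lambda>k. \<zeta> r k) \<longlonglongrightarrow> z)"
proof -
  interpret G: pair_graph G by (rule assms(1))
  define R where "R = pverts G"
  define E where "E = parcs G"
  define b where "b r = transpose_mult_vec (n r) (X r) (y r)" for r
  define h where "h = group_penalty \<mu> Nb B"
  have fin: "finite R" unfolding R_def by (rule G.pair_finite_verts)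
  have arcs: "E \<subseteq> R \<times> R" unfolding E_def R_def by (auto dest: G.in_arcsD1 G.in_arcsD2)
  have sym: "sym E" using G.pair_sym_arcs unfolding E_def symmetric_def by simp
  have conn: "(r, s) \<in> E\<^sup>*" if "r \<in> R" "s \<in> R" for r s
    using connected_imp_rtrancl[OF assms(1,3)] that unfolding E_def R_def by blast
  have ne: "R \<noteq> {}" using assms(3) unfolding R_def connected_def strongly_connected_def by simp
  have nbr: "neighbors G r = E `` {r}" for r by (auto simp: neighbors_def E_def)
  have iter: "dglasso_iterates G c \<mu> Nb B n X y \<zeta> \<gamma> p v" by (rule assms(8))
  have p_Suc: "p r (int k) = p r (int k - 1) + c *\<^sub>R (\<Sum>s\<in>E `` {r}. \<zeta> r k - \<zeta> s k)"
    and v_Suc: "v r (int k) = v r (int k - 1) + c *\<^sub>R (\<zeta> r k - \<gamma> r k)"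
    and \<zeta>_Suc: "\<And>\<nu>. \<nu> \<in> {1..Nb} \<Longrightarrow> subvec (B \<nu>) (\<zeta> r (k + 1)) =
             (1 / (c * real (card R) * (2 * real (card (E `` {r})) + 1))) *\<^sub>R
             soft_threshold \<mu>
               (real (card R) *\<^sub>R
                 (c *\<^sub>R subvec (B \<nu>) (\<gamma> r k)
                  + c *\<^sub>R (\<Sum>s\<in>E `` {r}. subvec (B \<nu>) (\<zeta> r k) + subvec (B \<nu>) (\<zeta> s k))
                  - subvec (B \<nu>) (p r (int k)) - subvec (B \<nu>) (v r (int k))))"
    and \<gamma>_Suc: "\<gamma> r (k + 1) = matrix_inv (c *\<^sub>R mat 1 + gram (n r) (X r)) *v
            (b r + c *\<^sub>R \<zeta> r (k + 1) + v r (int k))"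
    if "r \<in> R" for r k
    using iter that unfolding dglasso_iterates_def nbr R_def[symmetric] b_def by blast+
  \<comment> \<open>The normal equations of the \<open>\<gamma>\<close> update combined with the
    update of \<open>v\<close>. This holds from time 1 on; the values at time 0 are
    arbitrary.\<close>
  have v_grad: "v r (int (Suc k)) = gram (n r) (X r) *v \<gamma> r (Suc k) - b r" if "r \<in> R" for r k
  proof -
    have "c *\<^sub>R \<gamma> r (Suc k) + gram (n r) (X r) *v \<gamma> r (Suc k) = b r + c *\<^sub>R \<zeta> r (Suc k) + v r (int k)"
      using regularized_gram_solve[OF assms(7) \<gamma>_Suc[OF that, of k]] by simp
    then have "gram (n r) (X r) *v \<gamma> r (Suc k)
        = b r + c *\<^sub>R \<zeta> r (Suc k) + v r (int k) - c *\<^sub>R \<gamma> r (Suc k)"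
      by (simp only: eq_diff_eq add.commute)
    moreover have "v r (int (Suc k)) = v r (int k) + c *\<^sub>R (\<zeta> r (Suc k) - \<gamma> r (Suc k))"
      using v_Suc[OF that, of "Suc k"] by simp
    ultimately show ?thesis by (simp add: scaleR_diff_right)
  qed
  have diff_sum: "(\<Sum>r\<in>R. \<Sum>s\<in>E `` {r}. \<zeta> r k - \<zeta> s k) = 0" for k
  proof -
    have "(\<Sum>r\<in>R. \<Sum>s\<in>E `` {r}. \<zeta> s k) = (\<Sum>r\<in>R. \<Sum>s\<in>E `` {r}. \<zeta> r k)"
      unfolding sum_neighbors_eq_sum_arcs[OF fin arcs] by (rule sum_arcs_swap[OF sym])
    then show ?thesis by (simp only: sum_subtractf diff_self)
  qed
  have p_sum: "(\<Sum>r\<in>R. p r (int k)) = (\<Sum>r\<in>R. p r (int k - 1))" for k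
  proof -
    have "(\<Sum>r\<in>R. p r (int k)) = (\<Sum>r\<in>R. p r (int k - 1) + c *\<^sub>R (\<Sum>s\<in>E `` {r}. \<zeta> r k - \<zeta> s k))"
      by (intro sum.cong refl p_Suc)
    then show ?thesis
      by (simp only: sum.distrib diff_sum scaleR_zero_right add_0_right flip: scaleR_sum_right)
  qed
  \<comment> \<open>The zero initial sum enters here: an antisymmetric flow can only have a
    divergence of sum zero.\<close>
  have "(\<Sum>r\<in>R. p r (int 1)) = 0"
    using p_sum[of 1] p_sum[of 0] assms(9) by (simp add: R_def)
  then obtain m where m_antisym: "\<And>r s. m s r = - m r s"
    and m: "\<And>r. r \<in> R \<Longrightarrow> (\<Sum>s\<in>E `` {r}. m r s) = p r (int 1)"
    using antisymmetric_flow_exists[OF fin arcs sym conn, of "\<lambda>r. p r (int 1)"] by blast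
  \<comment> \<open>Starting from \<open>m\<close> and accumulating disagreements from time 2 on,
    \<open>l\<close> at index \<open>k\<close> has the divergence \<open>p\<close> at time
    \<open>Suc k\<close>.\<close>
  define l where "l r s k = m r s + c *\<^sub>R (\<Sum>j<k. \<zeta> r (Suc (Suc j)) - \<zeta> s (Suc (Suc j)))" for r s k
  have p_l: "(\<Sum>s\<in>E `` {r}. l r s k) = p r (int (Suc k))" if "r \<in> R" for r k
  proof (induction k)
    case 0
    then show ?case using m[OF that] by (simp add: l_def)
  next
    case (Suc k)
    have "(\<Sum>s\<in>E `` {r}. l r s (Suc k))
        = (\<Sum>s\<in>E `` {r}. l r s k + c *\<^sub>R (\<zeta> r (Suc (Suc k)) - \<zeta> s (Suc (Suc k))))"
      by (intro sum.cong refl) (simp add: l_def scaleR_add_right)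
    also have "\<dots> = p r (int (Suc k)) + c *\<^sub>R (\<Sum>s\<in>E `` {r}. \<zeta> r (Suc (Suc k)) - \<zeta> s (Suc (Suc k)))"
      by (simp only: sum.distrib Suc.IH flip: scaleR_sum_right)
    finally show ?case using p_Suc[OF that, of "Suc (Suc k)"] by simp
  qed
  \<comment> \<open>All sequences are shifted by one because \<open>v\<close> is a gradient only
    from time 1 on.\<close>
  interpret admm: consensus_admm R E c "\<lambda>r z. gram (n r) (X r) *v z" b h
    "\<lambda>r k. \<zeta> r (Suc k)" "\<lambda>r k. \<gamma> r (Suc k)" "\<lambda>r k. v r (int (Suc k))" l
  proof
    show "(gram (n r) (X r) *v x) \<bullet> x \<ge> 0" for r x
      unfolding inner_gram by (intro sum_nonneg) simp
    show "continuous_on UNIV h" unfolding h_def by (rule continuous_on_group_penalty)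
    show "v r (int (Suc (Suc k))) = v r (int (Suc k)) + c *\<^sub>R (\<zeta> r (Suc (Suc k)) - \<gamma> r (Suc (Suc k)))"
      if "r \<in> R" for r k
      using v_Suc[OF that, of "Suc (Suc k)"] by simp
    show "l s r k = - l r s k" for r s k
      unfolding l_def m_antisym[of s r] by (simp add: sum_subtractf scaleR_diff_right)
    show "l r s (Suc k) = l r s k + c *\<^sub>R (\<zeta> r (Suc (Suc k)) - \<zeta> s (Suc (Suc k)))" for r s k
      by (simp add: l_def scaleR_add_right)
    show "subgradient h (\<zeta> r (Suc (Suc k)))
      (real (card R) *\<^sub>R (c *\<^sub>R (\<gamma> r (Suc k) - \<gamma> r (Suc (Suc k))) - v r (int (Suc (Suc k)))
        - (\<Sum>s\<in>E `` {r}. l r s (Suc k))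
        + c *\<^sub>R (\<Sum>s\<in>E `` {r}. \<zeta> r (Suc k) + \<zeta> s (Suc k) - \<zeta> r (Suc (Suc k)) - \<zeta> s (Suc (Suc k)))))"
      if r: "r \<in> R" for r k
    proof -
      define d where "d = real (card (E `` {r}))"
      \<comment> \<open>The denominator of the \<open>\<zeta>\<close> update.\<close>
      define t where "t = c * real (card R) * (2 * d + 1)"
      define Z where "Z = (\<Sum>s\<in>E `` {r}. \<zeta> s (Suc k))"
      define Z' where "Z' = (\<Sum>s\<in>E `` {r}. \<zeta> s (Suc (Suc k)))"
      define w where "w = c *\<^sub>R \<gamma> r (Suc k) + c *\<^sub>R (\<Sum>s\<in>E `` {r}. \<zeta> r (Suc k) + \<zeta> s (Suc k))
        - p r (int (Suc k)) - v r (int (Suc k))"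
      have "t > 0"
        using assms(7) fin ne by (simp add: t_def d_def card_gt_0_iff add_nonneg_pos)
      have "subvec (B \<nu>) (\<zeta> r (Suc (Suc k)))
          = (1 / t) *\<^sub>R soft_threshold \<mu> (subvec (B \<nu>) (real (card R) *\<^sub>R w))" if "\<nu> \<in> {1..Nb}" for \<nu>
        using \<zeta>_Suc[OF r that, of "Suc k"] by (simp add: t_def d_def w_def)
      from soft_threshold_step_subgradient[OF assms(4-6) \<open>t > 0\<close> this]
      have sub: "subgradient h (\<zeta> r (Suc (Suc k))) (real (card R) *\<^sub>R w - t *\<^sub>R \<zeta> r (Suc (Suc k)))"
        unfolding h_def .
      have p': "p r (int (Suc (Suc k))) = p r (int (Suc k)) + c *\<^sub>R (d *\<^sub>R \<zeta> r (Suc (Suc k)) - Z')"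
        using p_Suc[OF r, of "Suc (Suc k)"]
          by (simp add: sum_subtractf sum_constant_scaleR d_def Z'_def del: sum_constant)
      have v': "v r (int (Suc (Suc k))) = v r (int (Suc k)) + c *\<^sub>R (\<zeta> r (Suc (Suc k)) - \<gamma> r (Suc (Suc k)))"
        using v_Suc[OF r, of "Suc (Suc k)"] by simp
      have S: "(\<Sum>s\<in>E `` {r}. \<zeta> r (Suc k) + \<zeta> s (Suc k) - \<zeta> r (Suc (Suc k)) - \<zeta> s (Suc (Suc k)))
          = d *\<^sub>R \<zeta> r (Suc k) + Z - d *\<^sub>R \<zeta> r (Suc (Suc k)) - Z'"
        by (simp add: sum_subtractf sum.distrib sum_constant_scaleR d_def Z_def Z'_def del: sum_constant)
      have W: "w = c *\<^sub>R \<gamma> r (Suc k) + c *\<^sub>R (d *\<^sub>R \<zeta> r (Suc k) + Z) - p r (int (Suc k)) - v r (int (Suc k))"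
        by (simp add: w_def sum.distrib sum_constant_scaleR d_def Z_def del: sum_constant)
      \<comment> \<open>The new \<open>p\<close>, the new \<open>v\<close> and the arc sum
        contribute \<open>d\<close>, \<open>1\<close> and \<open>d\<close> to the factor
        \<open>2 * d + 1\<close>. The new values \<open>Z'\<close> of the neighbors and the new
        \<open>\<gamma>\<close> cancel, which makes the update explicit.\<close>
      have "c *\<^sub>R (\<gamma> r (Suc k) - \<gamma> r (Suc (Suc k))) - v r (int (Suc (Suc k)))
          - p r (int (Suc (Suc k)))
          + c *\<^sub>R (d *\<^sub>R \<zeta> r (Suc k) + Z - d *\<^sub>R \<zeta> r (Suc (Suc k)) - Z')
        = w - (c * (2 * d + 1)) *\<^sub>R \<zeta> r (Suc (Suc k))"
        unfolding p' v' W
        by (simp add: vec_eq_iff algebra_simps)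
      then have "real (card R) *\<^sub>R (c *\<^sub>R (\<gamma> r (Suc k) - \<gamma> r (Suc (Suc k))) - v r (int (Suc (Suc k)))
          - p r (int (Suc (Suc k)))
          + c *\<^sub>R (d *\<^sub>R \<zeta> r (Suc k) + Z - d *\<^sub>R \<zeta> r (Suc (Suc k)) - Z'))
        = real (card R) *\<^sub>R w - t *\<^sub>R \<zeta> r (Suc (Suc k))"
        by (simp add: scaleR_diff_right t_def mult_ac)
      then show ?thesis
        using sub by (simp only: p_l[OF r] S)
    qed
  qed (use fin ne arcs sym conn assms(7) v_grad in
      \<open>simp_all add: matrix_vector_right_distrib matrix_vector_mult_scaleR\<close>)
  obtain z0 where "subgradient h z0 (- (\<Sum>r\<in>R. gram (n r) (X r) *v z0 - b r))"
    using optimal_exists[OF assms(4-6) fin] unfolding h_def b_def by blast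
  then obtain z where z: "subgradient h z (- (\<Sum>r\<in>R. gram (n r) (X r) *v z - b r))"
    and lim: "\<And>r. r \<in> R \<Longrightarrow> (\<lambda>k. \<zeta> r (Suc k)) \<longlonglongrightarrow> z"
    using admm.convergence by blast
  have "is_arg_min (glasso_cost (pverts G) \<mu> Nb B n X y) (\<lambda>_. True) z"
    using optimal_imp_arg_min z unfolding h_def b_def R_def by blast
  moreover have "\<forall>r\<in>pverts G. (\<lambda>k. \<zeta> r k) \<longlonglongrightarrow> z"
    using lim unfolding R_def by (blast intro: LIMSEQ_imp_Suc)
  ultimately show ?thesis by blast
qed

end
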